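(* Let $k$ be an algebraically closed field of characteristic $p=2$. Let $A=k[[u,v]]$, endowed with a non-trivial action of $G=\mathbb{Z}/2\mathbb{Z}$ (by $k$-algebra automorphisms). Then there exists a power series ring $R:=k[[x,y]]$ such that $A^G$ is $k$-isomorphic to $R[z]/(z^2+sz+t)$, with $s,t\in R$.
   Context: $A^G$ denotes the ring of invariants; $R=k[[x,y]]$ is the formal power series ring in two variables over $k$, and $z$ is an indeterminate over $R$. *)

theory Defs
  imports
    "HOL-Algebra.Algebraic_Closure_Type"
    "HOL-Algebra.Group_Action"
    "HOL-Algebra.Elementary_Groups"
    "HOL-Algebra.QuotRing"
    "HOL-Computational_Algebra.Computational_Algebra"
begin

text \<open>
  The ring \<open>k[[u,v]]\<close> is the iterated power series ring \<open>k[[u]][[v]]\<close>: the coefficient of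
  \<open>u\<^sup>j v\<^sup>i\<close> in \<open>f\<close> is \<open>fps_nth (fps_nth f i) j\<close>.  The lemma below states that multiplication
  is the Cauchy product over pairs of exponents; addition is coefficientwise by definition.
\<close>
type_synonym 'k fps2 = "'k fps fps"

lemma fps2_mult_nth:
  fixes f g :: "'k::comm_ring_1 fps2"
  shows "fps_nth (fps_nth (f * g) n) m =
    (\<Sum>i=0..n. \<Sum>j=0..m. fps_nth (fps_nth f i) j * fps_nth (fps_nth g (n - i)) (m - j))"
  by (simp add: fps_mult_nth fps_sum_nth)

definition fps2_const :: "'k::comm_ring_1 \<Rightarrow> 'k fps2"
  where "fps2_const c = fps_const (fps_const c)"

abbreviation fps2_ring :: "'k::comm_ring_1 fps2 ring"
  where "fps2_ring \<equiv> ring_of_type_algebra"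

abbreviation fps2_poly_ring :: "'k::comm_ring_1 fps2 poly ring"
  where "fps2_poly_ring \<equiv> ring_of_type_algebra"

text \<open>
  A \<open>k\<close>-algebra is given by a ring together with its structure map from \<open>k\<close>; the isomorphisms
  of \<open>k\<close>-algebras are the ring isomorphisms that commute with the structure maps.
\<close>
definition algebra_iso ::
    "('a, 'm) ring_scheme \<Rightarrow> ('k \<Rightarrow> 'a) \<Rightarrow> ('b, 'n) ring_scheme \<Rightarrow> ('k \<Rightarrow> 'b) \<Rightarrow> ('a \<Rightarrow> 'b) set"
  where "algebra_iso A i B j = {h \<in> ring_iso A B. \<forall>c. h (i c) = j c}"

definition algebra_action ::
    "('g, 'l) monoid_scheme \<Rightarrow> ('a, 'm) ring_scheme \<Rightarrow> ('k \<Rightarrow> 'a) \<Rightarrow> ('g \<Rightarrow> 'a \<Rightarrow> 'a) \<Rightarrow> bool"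
  where "algebra_action G A i \<phi> \<longleftrightarrow>
    group_action G (carrier A) \<phi> \<and> (\<forall>g\<in>carrier G. \<phi> g \<in> algebra_iso A i A i)"

definition nontrivial_action ::
    "('g, 'l) monoid_scheme \<Rightarrow> ('a, 'm) ring_scheme \<Rightarrow> ('g \<Rightarrow> 'a \<Rightarrow> 'a) \<Rightarrow> bool"
  where "nontrivial_action G A \<phi> \<longleftrightarrow> (\<exists>g\<in>carrier G. \<exists>a\<in>carrier A. \<phi> g a \<noteq> a)"

definition invariant_ring ::
    "('g, 'l) monoid_scheme \<Rightarrow> ('a, 'm) ring_scheme \<Rightarrow> ('g \<Rightarrow> 'a \<Rightarrow> 'a) \<Rightarrow> ('a, 'm) ring_scheme"
  where "invariant_ring G A \<phi> =
    A\<lparr>carrier := {a \<in> carrier A. \<forall>g\<in>carrier G. \<phi> g a = a}\<rparr>"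

text \<open>\<open>R[z]/(f)\<close> for \<open>R = k[[x,y]]\<close>, and the canonical map \<open>k \<rightarrow> R \<rightarrow> R[z] \<rightarrow> R[z]/(f)\<close>.\<close>

definition fps2_poly_quot :: "'k::comm_ring_1 fps2 poly \<Rightarrow> 'k fps2 poly set ring"
  where "fps2_poly_quot f = fps2_poly_ring Quot (PIdl\<^bsub>fps2_poly_ring\<^esub> f)"

definition fps2_poly_quot_const ::
    "'k::comm_ring_1 fps2 poly \<Rightarrow> 'k \<Rightarrow> 'k fps2 poly set"
  where "fps2_poly_quot_const f c =
    (PIdl\<^bsub>fps2_poly_ring\<^esub> f) +>\<^bsub>fps2_poly_ring\<^esub> [:fps2_const c:]"

end

theory Submission
  imports Defs "HOL-Library.Nat_Bijection"
begin

text \<open>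
  Let \<open>\<sigma>\<close> be the involution.  In suitable coordinates \<open>X, Y\<close> of \<open>A\<close> its linear part is
  unitriangular, so the norms \<open>x = X \<sigma>(X)\<close> and \<open>y = Y \<sigma>(Y)\<close> have initial forms \<open>X\<^sup>2\<close> and
  \<open>Y\<^sup>2 + \<gamma> X Y\<close>, and \<open>A\<close> is free over \<open>R = k[[x,y]]\<close> with basis \<open>1, X, Y, XY\<close>.  The image of
  \<open>A\<^sup>G\<close> in \<open>A/R\<close>, a free module of rank three, is saturated because \<open>\<sigma>\<close> is \<open>R\<close>-linear, and it
  has rank one, so it is generated by the class of a single invariant \<open>z\<close>.  Hence \<open>A\<^sup>G = R \<oplus> R z\<close>,
  and \<open>z\<^sup>2 \<in> R + R z\<close> is the quadratic equation.
\<close>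

text \<open>The order of the group equals the characteristic, so invariants cannot be produced by
  averaging. Characteristic 2 itself helps in three places: the diagonal entries of a triangular
  linear part have square 1 and hence equal 1; every difference \<sigma>(f) - f is again invariant,
  which leads to an invariant outside R; and \<sigma>(X) - X becomes an invariant coordinate when
  the linear part is not triangular. No continuity of \<sigma> is given; it comes from the fact that
  an automorphism preserves units. That the rank is one would follow from degrees of fraction
  fields. Here it is seen inside A: two invariants independent modulo R would make the vector of
  differences \<sigma>(e) - e, for e = X, Y, XY, proportional to a nonzero vector over R, and
  multiplication by X or Y, with its norm in R, turns this into an R-linear relation among 1, X, Y,
  XY.\<close>

abbreviation cf :: "'k::comm_ring_1 fps2 \<Rightarrow> nat \<Rightarrow> nat \<Rightarrow> 'k"
  where "cf f i j \<equiv> fps_nth (fps_nth f i) j"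

abbreviation fps2_X :: "'k::comm_ring_1 fps2" where "fps2_X \<equiv> fps_X"
abbreviation fps2_Y :: "'k::comm_ring_1 fps2" where "fps2_Y \<equiv> fps_const fps_X"

lemma fps2_eqI: "(\<And>i j. cf f i j = cf g i j) \<Longrightarrow> f = g"
  by (simp add: fps_eq_iff)

lemma fps2_const_simps [simp]:
  "fps2_const 0 = 0" "fps2_const 1 = 1"
  by (simp_all add: fps2_const_def)

lemma cf_const_mult [simp]: "cf (fps2_const c * f) i j = c * cf f i j"
  by (simp add: fps2_const_def)

lemma cf_mult_const [simp]: "cf (f * fps2_const c) i j = cf f i j * c"
  by (simp add: fps2_const_def)

lemma cf_const: "cf (fps2_const c) i j = (if i = 0 \<and> j = 0 then c else 0)"
  by (simp add: fps2_const_def fps_const_def)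

lemma fps2_const_mult: "fps2_const (c * d) = fps2_const c * fps2_const d"
  by (simp add: fps2_const_def)

subsection \<open>Powers of the maximal ideal\<close>

definition mpow :: "nat \<Rightarrow> 'k::comm_ring_1 fps2 set"
  where "mpow n = {f. \<forall>i j. i + j < n \<longrightarrow> cf f i j = 0}"

lemma mpow_0 [simp]: "f \<in> mpow 0"
  by (simp add: mpow_def)

lemma zero_in_mpow [simp]: "0 \<in> mpow n"
  by (simp add: mpow_def)

lemma mpow_antimono: "f \<in> mpow n \<Longrightarrow> m \<le> n \<Longrightarrow> f \<in> mpow m"
  by (auto simp: mpow_def)

lemma mpow_add: "f \<in> mpow n \<Longrightarrow> g \<in> mpow n \<Longrightarrow> f + g \<in> mpow n"
  by (auto simp: mpow_def)

lemma mpow_diff: "f \<in> mpow n \<Longrightarrow> g \<in> mpow n \<Longrightarrow> f - g \<in> mpow n"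
  by (auto simp: mpow_def)

lemma mpow_sum: "(\<And>i. i \<in> I \<Longrightarrow> f i \<in> mpow n) \<Longrightarrow> sum f I \<in> mpow n"
  by (induction I rule: infinite_finite_induct) (auto intro: mpow_add)

lemma mpow_mult:
  assumes "f \<in> mpow a" "g \<in> mpow b" shows "f * g \<in> mpow (a + b)"
  unfolding mpow_def
proof (intro CollectI allI impI)
  fix n m assume nm: "n + m < a + b"
  have "cf f i j * cf g (n - i) (m - j) = 0" if "i \<le> n" "j \<le> m" for i j
  proof (cases "i + j < a")
    case False
    then have "n - i + (m - j) < b" using nm that by linarith
    then show ?thesis using assms by (simp add: mpow_def)
  qed (use assms in \<open>simp add: mpow_def\<close>)
  then show "cf (f * g) n m = 0"
    unfolding fps2_mult_nth by (intro sum.neutral ballI) auto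
qed

lemma mpow_mult_right: "g \<in> mpow n \<Longrightarrow> f * g \<in> mpow n"
  using mpow_mult[of f 0 g n] by simp

lemma mpow_mult_left: "f \<in> mpow n \<Longrightarrow> f * g \<in> mpow n"
  using mpow_mult[of f n g 0] by simp

lemma mpow_power: "f \<in> mpow 1 \<Longrightarrow> f ^ n \<in> mpow n"
proof (induction n)
  case (Suc n)
  then show ?case using mpow_mult[of f 1 "f ^ n" n] by simp
qed auto

lemma mpow_separated: "(\<And>n. f \<in> mpow n) \<Longrightarrow> f = 0"
  by (rule fps2_eqI) (auto simp: mpow_def)

lemma mpow_eqI: "(\<And>n. f - g \<in> mpow n) \<Longrightarrow> f = g"
  using mpow_separated[of "f - g"] by simp

lemma fps2_X_in_mpow [simp]: "fps2_X \<in> mpow (Suc 0)"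
  by (auto simp: mpow_def)

lemma fps2_Y_in_mpow [simp]: "fps2_Y \<in> mpow (Suc 0)"
  by (auto simp: mpow_def fps_const_def)

lemma mpow_1_iff: "f \<in> mpow (Suc 0) \<longleftrightarrow> cf f 0 0 = 0"
  by (auto simp: mpow_def)

lemma fps2_split:
  obtains f1 f2 where "f = fps2_const (cf f 0 0) + fps2_X * f1 + fps2_Y * f2"
proof
  show "f = fps2_const (cf f 0 0) + fps2_X * fps_shift 1 f
     + fps2_Y * fps_const (fps_shift 1 (fps_nth f 0))"
  proof (rule fps2_eqI)
    fix i j show "cf f i j = cf (fps2_const (cf f 0 0) + fps2_X * fps_shift 1 f
     + fps2_Y * fps_const (fps_shift 1 (fps_nth f 0))) i j"
      by (cases i; cases j) (auto simp: cf_const)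
  qed
qed

lemma fps2_unit:
  fixes f :: "'k::field fps2"
  assumes "cf f 0 0 \<noteq> 0"
  obtains g where "f * g = 1"
proof -
  have "fps_nth f 0 * inverse (fps_nth f 0) = 1"
    using assms by (simp add: inverse_mult_eq_1')
  then show ?thesis using that fps_right_inverse by blast
qed

subsection \<open>Series in a family of elements of increasing order\<close>

text \<open>Encodes an infinite sum without a topology: when \<open>E i j\<close> lies in
  \<open>mpow (i + j)\<close>, only indices with \<open>i + j \<le> n + m\<close> reach the
  coefficient at \<open>(n, m)\<close>, so the square cut at \<open>Suc (n + m)\<close> loses
  nothing.\<close>

definition fps2_series :: "(nat \<Rightarrow> nat \<Rightarrow> 'k::comm_ring_1 fps2) \<Rightarrow> 'k fps2 \<Rightarrow> 'k fps2"
  where "fps2_series E c =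
    Abs_fps (\<lambda>n. Abs_fps (\<lambda>m. \<Sum>i<Suc (n + m). \<Sum>j<Suc (n + m). cf c i j * cf (E i j) n m))"

lemma cf_fps2_series:
  assumes "\<And>i j. E i j \<in> mpow (i + j)" "n + m < N"
  shows "cf (fps2_series E c) n m = (\<Sum>i<N. \<Sum>j<N. cf c i j * cf (E i j) n m)"
proof -
  have z: "cf (E i j) n m = 0" if "n + m < i + j" for i j
    using assms(1)[of i j] that by (simp add: mpow_def)
  have "(\<Sum>i<N. \<Sum>j<N. cf c i j * cf (E i j) n m) =
        (\<Sum>(i,j)\<in>{..<N} \<times> {..<N}. cf c i j * cf (E i j) n m)"
    by (simp add: sum.cartesian_product)
  also have "\<dots> = (\<Sum>(i,j)\<in>{..<Suc (n+m)} \<times> {..<Suc (n+m)}. cf c i j * cf (E i j) n m)"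
  proof (intro sum.mono_neutral_right ballI)
    fix p assume "p \<in> {..<N} \<times> {..<N} - {..<Suc (n+m)} \<times> {..<Suc (n+m)}"
    then show "(case p of (i, j) \<Rightarrow> cf c i j * cf (E i j) n m) = 0"
      using z[of "fst p" "snd p"] by (cases p) force
  qed (use assms(2) in auto)
  finally show ?thesis
    by (simp add: fps2_series_def sum.cartesian_product del: sum.lessThan_Suc)
qed

abbreviation fps2_partial :: "(nat \<Rightarrow> nat \<Rightarrow> 'k::comm_ring_1 fps2) \<Rightarrow> 'k fps2 \<Rightarrow> nat \<Rightarrow> 'k fps2"
  where "fps2_partial E c N \<equiv> (\<Sum>i<N. \<Sum>j<N. fps2_const (cf c i j) * E i j)"

lemma fps2_series_approx:
  assumes "\<And>i j. E i j \<in> mpow (i + j)"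
  shows "fps2_series E c - fps2_partial E c N \<in> mpow N"
  using cf_fps2_series[OF assms] by (auto simp: mpow_def fps_sum_nth)

text \<open>Limits are unique in the adic topology. Agreement along some arbitrarily large
  truncations is enough, which suits the later splitting by parity, where truncations at
  \<open>2 * N\<close> are compared.\<close>

lemma fps2_series_unique:
  assumes E: "\<And>i j. E i j \<in> mpow (i + j)" and f: "\<And>N. \<exists>M\<ge>N. f - fps2_partial E c M \<in> mpow N"
  shows "fps2_series E c = f"
proof (rule mpow_eqI)
  fix N
  obtain M where M: "M \<ge> N" "f - fps2_partial E c M \<in> mpow N" using f by blast
  have "fps2_series E c - fps2_partial E c M \<in> mpow N"
    using mpow_antimono[OF fps2_series_approx[OF E] M(1)] .
  from mpow_diff[OF this M(2)] show "fps2_series E c - f \<in> mpow N" by simp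
qed

lemma fps2_series_add: "fps2_series E (c + d) = fps2_series E c + fps2_series E d"
  by (rule fps2_eqI) (simp add: fps2_series_def algebra_simps sum.distrib)

lemma fps2_series_diff: "fps2_series E (c - d) = fps2_series E c - fps2_series E d"
  using fps2_series_add[of E "c - d" d] by simp

subsection \<open>Triangular families\<close>

text \<open>The exponents are ordered by total degree and then by the exponent of \<open>fps2_X\<close>, which is the
  order of their Cantor codes.\<close>

abbreviation exp_rank :: "nat \<Rightarrow> nat \<Rightarrow> nat" where "exp_rank i j \<equiv> prod_encode (i, j)"

lemma exp_rank_less_iff:
  "exp_rank a b < exp_rank i j \<longleftrightarrow> a + b < i + j \<or> a + b = i + j \<and> a < i"
proof -
  \<comment> \<open>The codes of total degree \<open>n\<close> start at \<open>triangle n\<close>;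
    those of degree \<open>m\<close> end at \<open>triangle m + m\<close>.\<close>
  have mono: "triangle m + m < triangle n" if "m < n" for m n
    using that by (induction n) (auto simp: less_Suc_eq)
  have "exp_rank a b < exp_rank i j" if "a + b < i + j" for a b i j
    using mono[OF that] by (auto simp: prod_encode_def)
  from this[of a b i j] this[of i j a b] show ?thesis
    by (cases "a + b" "i + j" rule: linorder_cases) (auto simp: prod_encode_def)
qed

text \<open>A leading term for a local order, where the smallest exponent leads. As
  \<open>(0, 1)\<close> precedes \<open>(1, 0)\<close>, \<open>monic_at 1 0\<close> excludes a
  linear \<open>fps2_Y\<close> term while \<open>monic_at 0 1\<close> tolerates a linear
  \<open>fps2_X\<close> term: imposed on the images of \<open>fps2_X\<close> and
  \<open>fps2_Y\<close>, the two conditions describe a unitriangular linear part.\<close>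

definition monic_at :: "nat \<Rightarrow> nat \<Rightarrow> 'k::comm_ring_1 fps2 \<Rightarrow> bool"
  where "monic_at i j f \<longleftrightarrow> cf f i j = 1 \<and> (\<forall>a b. exp_rank a b < exp_rank i j \<longrightarrow> cf f a b = 0)"

lemma monic_at_one: "monic_at 0 0 1"
  by (simp add: monic_at_def exp_rank_less_iff)

lemma monic_at_mpow: "monic_at i j f \<Longrightarrow> f \<in> mpow (i + j)"
  by (simp add: monic_at_def exp_rank_less_iff mpow_def)

text \<open>The order is compatible with addition of exponents: if \<open>(n, m)\<close> precedes a
  sum, then in every decomposition of \<open>(n, m)\<close> one part precedes the corresponding
  summand. At the sum itself only the product of the leading terms survives.\<close>

lemma monic_at_mult:
  assumes "monic_at i j f" "monic_at k l g"
  shows "monic_at (i + k) (j + l) (f * g)"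
proof -
  have *: "cf f a b * cf g (n - a) (m - b) = 0"
    if "a \<le> n" "b \<le> m" "exp_rank a b < exp_rank i j \<or> exp_rank (n - a) (m - b) < exp_rank k l" for a b n m
    using that assms unfolding monic_at_def by fastforce
  have "cf (f * g) n m = 0" if nm: "exp_rank n m < exp_rank (i + k) (j + l)" for n m
    unfolding fps2_mult_nth
  proof (intro sum.neutral ballI *)
    fix a b assume "a \<in> {0..n}" "b \<in> {0..m}"
    then show "exp_rank a b < exp_rank i j \<or> exp_rank (n - a) (m - b) < exp_rank k l"
      using nm unfolding exp_rank_less_iff by auto
  qed auto
  moreover have "cf (f * g) (i + k) (j + l) = 1"
  proof -
    have z: "cf f a b * cf g (i + k - a) (j + l - b) = 0"
      if "a \<le> i + k" "b \<le> j + l" "(a, b) \<noteq> (i, j)" for a b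
      by (rule *) (use that in \<open>auto simp: exp_rank_less_iff\<close>)
    have "cf (f * g) (i + k) (j + l) =
       (\<Sum>(a,b)\<in>{0..i+k} \<times> {0..j+l}. cf f a b * cf g (i + k - a) (j + l - b))"
      by (simp add: fps2_mult_nth sum.cartesian_product)
    also have "\<dots> = (\<Sum>(a,b)\<in>{(i,j)}. cf f a b * cf g (i + k - a) (j + l - b))"
    proof (intro sum.mono_neutral_right ballI)
      fix p assume "p \<in> {0..i+k} \<times> {0..j+l} - {(i, j)}"
      then show "(case p of (a, b) \<Rightarrow> cf f a b * cf g (i + k - a) (j + l - b)) = 0"
        using z[of "fst p" "snd p"] by (cases p) force
    qed auto
    finally show ?thesis using assms by (simp add: monic_at_def)
  qed
  ultimately show ?thesis by (simp add: monic_at_def)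
qed

lemma monic_at_power: "monic_at i j f \<Longrightarrow> monic_at (n * i) (n * j) (f ^ n)"
  by (induction n) (auto simp: monic_at_one intro: monic_at_mult)

text \<open>The matrix from \<open>c\<close> to the coefficients of the series is unitriangular: row
  \<open>(n, m)\<close> sees only entries of \<open>c\<close> whose code is at most that of
  \<open>(n, m)\<close>, with 1 on the diagonal.\<close>

lemma fps2_series_triangular:
  fixes E :: "nat \<Rightarrow> nat \<Rightarrow> 'k::comm_ring_1 fps2"
  assumes E: "\<And>i j. monic_at i j (E i j)" and c: "\<And>a b. exp_rank a b < exp_rank n m \<Longrightarrow> cf c a b = 0"
  shows "cf (fps2_series E c) n m = cf c n m"
    and "exp_rank a b < exp_rank n m \<Longrightarrow> cf (fps2_series E c) a b = 0"
proof -
  have z: "cf c i j * cf (E i j) n' m' = 0"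
    if "exp_rank n' m' < exp_rank n m \<or> n' = n \<and> m' = m \<and> (i, j) \<noteq> (n, m)" for i j n' m'
  proof (cases "exp_rank i j < exp_rank n m")
    case False
    have "exp_rank n' m' < exp_rank i j"
    proof (cases "exp_rank n' m' < exp_rank n m")
      case False
      with that \<open>\<not> exp_rank i j < exp_rank n m\<close> show ?thesis
        by (metis linorder_neqE_nat prod_encode_eq)
    qed (use False in auto)
    then show ?thesis using E[of i j] by (simp add: monic_at_def)
  qed (use c in auto)
  show "cf (fps2_series E c) a b = 0" if "exp_rank a b < exp_rank n m"
    using that by (simp add: fps2_series_def z)
  have "cf (fps2_series E c) n m =
     (\<Sum>(i,j)\<in>{..<Suc (n+m)} \<times> {..<Suc (n+m)}. cf c i j * cf (E i j) n m)"
    by (simp add: fps2_series_def sum.cartesian_product del: sum.lessThan_Suc)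
  also have "\<dots> = (\<Sum>(i,j)\<in>{(n,m)}. cf c i j * cf (E i j) n m)"
  proof (intro sum.mono_neutral_right ballI)
    fix p assume "p \<in> {..<Suc (n+m)} \<times> {..<Suc (n+m)} - {(n, m)}"
    then show "(case p of (i, j) \<Rightarrow> cf c i j * cf (E i j) n m) = 0"
      using z[of n m "fst p" "snd p"] by (cases p) force
  qed auto
  finally show "cf (fps2_series E c) n m = cf c n m"
    using E[of n m] by (simp add: monic_at_def)
qed

text \<open>Each exponent has only finitely many predecessors, so the infinite unitriangular system
  can be solved by forward substitution along the codes.\<close>

lemma fps2_series_bij:
  fixes E :: "nat \<Rightarrow> nat \<Rightarrow> 'k::comm_ring_1 fps2"
  assumes E: "\<And>i j. monic_at i j (E i j)"
  shows "bij (fps2_series E)"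
proof (rule bijI)
  show "inj (fps2_series E)"
  proof (rule injI)
    fix c d assume eq: "fps2_series E c = fps2_series E d"
    have "cf (c - d) i j = 0" for i j
    proof (induction "exp_rank i j" arbitrary: i j rule: less_induct)
      case less
      have "cf (fps2_series E (c - d)) i j = cf (c - d) i j"
        by (rule fps2_series_triangular[OF E]) (rule less, assumption)
      then show ?case by (simp add: fps2_series_diff eq)
    qed
    then show "c = d" by (intro fps2_eqI) simp
  qed
  show "surj (fps2_series E)"
  proof (rule surjI)
    fix f :: "'k fps2"
    define mon :: "'k \<Rightarrow> nat \<Rightarrow> 'k fps2" where
      "mon = (\<lambda>a n. Abs_fps (\<lambda>i. Abs_fps (\<lambda>j. if n = exp_rank i j then a else 0)))"
    define nth where "nth = (\<lambda>(g::'k fps2) n. case prod_decode n of (i, j) \<Rightarrow> cf g i j)"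
    have nth: "nth g (exp_rank i j) = cf g i j" for g i j
      by (simp add: nth_def)
    \<comment> \<open>\<open>g n\<close> solves the system at all codes below \<open>n\<close>. The
      added monomial cancels the error at code \<open>n\<close> and, by triangularity, disturbs no
      earlier coefficient.\<close>
    define g where "g = rec_nat 0 (\<lambda>n g. g + mon (nth (f - fps2_series E g) n) n)"
    have g0: "g 0 = 0" and gS: "g (Suc n) = g n + mon (nth (f - fps2_series E (g n)) n) n" for n
      by (simp_all add: g_def)
    have cfmon: "cf (mon a n) i j = (if n = exp_rank i j then a else 0)" for a n i j
      by (simp add: mon_def)
    have stable: "cf (g n) i j = cf (g (Suc (exp_rank i j))) i j" if "n > exp_rank i j" for n i j
      using Suc_leI[OF that]
      by (induction n rule: dec_induct) (auto simp: gS[of n for n] cfmon)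
    have approx: "cf (fps2_series E (g n)) i j = cf f i j" if "exp_rank i j < n" for n i j
      using that
    proof (induction n arbitrary: i j)
      case (Suc n)
      obtain a b where n: "n = exp_rank a b" by (metis prod_decode_inverse surj_pair)
      let ?a = "nth (f - fps2_series E (g n)) n"
      have tr: "cf (mon ?a n) i j = 0" if "exp_rank i j < exp_rank a b" for i j
        using that by (auto simp: cfmon n)
      have 1: "cf (fps2_series E (mon ?a n)) a b = ?a"
        using fps2_series_triangular(1)[OF E tr] by (simp add: cfmon n)
      have 2: "cf (fps2_series E (mon ?a n)) i j = 0" if "exp_rank i j < n" for i j
        using fps2_series_triangular(2)[OF E tr] that n by simp
      show ?case
      proof (cases "exp_rank i j = n")
        case True
        then have "i = a" "j = b" using n by auto
        then show ?thesis using 1 by (simp add: gS fps2_series_add) (simp add: n nth)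
      next
        case False
        then show ?thesis using Suc 2[of i j] by (simp add: gS fps2_series_add)
      qed
    qed simp
    \<comment> \<open>The diagonal limit: the entry at \<open>(i, j)\<close> is fixed in the step
      numbered \<open>exp_rank i j\<close> and stays constant afterwards.\<close>
    define c where "c = Abs_fps (\<lambda>i. Abs_fps (\<lambda>j. cf (g (Suc (exp_rank i j))) i j))"
    have c: "cf c i j = cf (g n) i j" if "exp_rank i j < n" for i j n
      using stable[OF that] by (simp add: c_def)
    show "fps2_series E (SOME c. fps2_series E c = f) = f"
    proof (rule someI)
      show "fps2_series E c = f"
      proof (rule fps2_eqI)
        fix i j
        let ?n = "Suc (exp_rank i j)"
        obtain a b where ab: "?n = exp_rank a b" by (metis prod_decode_inverse surj_pair)
        have "cf (fps2_series E (c - g ?n)) i j = 0"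
          by (rule fps2_series_triangular(2)[OF E, of a b]) (auto simp: ab[symmetric] c)
        then show "cf (fps2_series E c) i j = cf f i j"
          by (simp add: fps2_series_diff approx)
      qed
    qed
  qed
qed

subsection \<open>Algebra endomorphisms and substitution\<close>

locale fps2_hom =
  fixes h :: "'k::field fps2 \<Rightarrow> 'k fps2"
  assumes add: "h (f + g) = h f + h g"
    and mult: "h (f * g) = h f * h g"
    and const [simp]: "h (fps2_const c) = fps2_const c"
begin

lemma zero [simp]: "h 0 = 0"
  using const[of 0] by simp

lemma one [simp]: "h 1 = 1"
  using const[of 1] by simp

lemma diff: "h (f - g) = h f - h g"
  using add[of "f - g" g] by simp

lemma uminus: "h (- f) = - h f"
  using diff[of 0 f] by simp

lemma power: "h (f ^ n) = h f ^ n"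
  by (induction n) (simp_all add: mult)

end

lemma fps2_hom_comp: "fps2_hom f \<Longrightarrow> fps2_hom g \<Longrightarrow> fps2_hom (\<lambda>x. f (g x))"
  by (simp add: fps2_hom_def)

lemma fps2_hom_inv:
  assumes "fps2_hom h" "bij h" shows "fps2_hom (inv_into UNIV h)"
proof -
  interpret fps2_hom h by fact
  have hi: "h (inv_into UNIV h x) = x" for x using \<open>bij h\<close> by (simp add: bij_is_surj surj_f_inv_f)
  have ih: "inv_into UNIV h (h x) = x" for x using \<open>bij h\<close> by (simp add: bij_is_inj)
  show ?thesis
  proof
    show "inv_into UNIV h (f + g) = inv_into UNIV h f + inv_into UNIV h g" for f g
      using ih[of "inv_into UNIV h f + inv_into UNIV h g"] by (simp add: add hi)
    show "inv_into UNIV h (f * g) = inv_into UNIV h f * inv_into UNIV h g" for f g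
      using ih[of "inv_into UNIV h f * inv_into UNIV h g"] by (simp add: mult hi)
    show "inv_into UNIV h (fps2_const c) = fps2_const c" for c
      using ih[of "fps2_const c"] by simp
  qed
qed

section \<open>Evaluation at a pair of series without constant term\<close>

definition fps2_subst :: "'k::field fps2 \<Rightarrow> 'k fps2 \<Rightarrow> 'k fps2 \<Rightarrow> 'k fps2"
  where "fps2_subst p q = fps2_series (\<lambda>i j. p ^ i * q ^ j)"

lemma mpow_power_mult:
  assumes "p \<in> mpow 1" "q \<in> mpow 1" shows "p ^ i * q ^ j \<in> mpow (i + j)"
  using assms by (intro mpow_mult mpow_power)

lemma fps2_subst_approx:
  assumes "p \<in> mpow 1" "q \<in> mpow 1"
  shows "fps2_subst p q F - fps2_partial (\<lambda>i j. p ^ i * q ^ j) F N \<in> mpow N"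
  unfolding fps2_subst_def using mpow_power_mult[OF assms] by (rule fps2_series_approx)

lemma fps2_subst_eqI:
  assumes "p \<in> mpow 1" "q \<in> mpow 1"
    and "\<And>N. f - fps2_partial (\<lambda>i j. p ^ i * q ^ j) F N \<in> mpow N"
  shows "fps2_subst p q F = f"
  unfolding fps2_subst_def using mpow_power_mult[OF assms(1,2)]
  by (rule fps2_series_unique) (use assms(3) in auto)

lemma fps2_subst_add: "fps2_subst p q (F + G) = fps2_subst p q F + fps2_subst p q G"
  by (simp add: fps2_subst_def fps2_series_add)

lemma fps2_subst_const_mult:
  "fps2_subst p q (fps2_const c * F) = fps2_const c * fps2_subst p q F"
  by (rule fps2_eqI) (simp add: fps2_subst_def fps2_series_def sum_distrib_left mult_ac
      del: sum.lessThan_Suc)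

lemma fps2_subst_one:
  assumes "p \<in> mpow 1" "q \<in> mpow 1" shows "fps2_subst p q 1 = 1"
proof (rule fps2_subst_eqI[OF assms])
  fix N :: nat
  have "fps2_partial (\<lambda>i j. p ^ i * q ^ j) 1 N =
        (\<Sum>i<N. \<Sum>j<N. if i = 0 then if j = 0 then 1 else 0 else 0)"
    by (intro sum.cong) auto
  also have "\<dots> = (if N = 0 then 0 else 1)"
    by (cases N) (simp_all add: sum.lessThan_Suc_shift del: sum.lessThan_Suc)
  finally show "1 - fps2_partial (\<lambda>i j. p ^ i * q ^ j) 1 N \<in> mpow N"
    by simp
qed

lemma fps2_subst_const:
  "p \<in> mpow 1 \<Longrightarrow> q \<in> mpow 1 \<Longrightarrow> fps2_subst p q (fps2_const c) = fps2_const c"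
  using fps2_subst_const_mult[of p q c 1] by (simp add: fps2_subst_one)

lemma fps2_subst_X_mult:
  assumes p: "p \<in> mpow 1" and q: "q \<in> mpow 1"
  shows "fps2_subst p q (fps2_X * F) = p * fps2_subst p q F"
proof (rule fps2_subst_eqI[OF p q])
  fix N :: nat
  let ?E = "\<lambda>i j. p ^ i * q ^ j"
  have 1: "fps2_partial ?E (fps2_X * F) (Suc N) =
    p * (\<Sum>i<N. \<Sum>j<Suc N. fps2_const (cf F i j) * ?E i j)" for N
    by (subst sum.lessThan_Suc_shift[of _ N])
       (simp add: sum_distrib_left mult_ac del: sum.lessThan_Suc)
  \<comment> \<open>The square truncation of \<open>F\<close> exceeds the shifted one by the row
    \<open>i = N\<close>, which is small because of its factor \<open>p ^ N\<close>. The order lost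
    by passing from \<open>Suc M\<close> to \<open>M\<close> below is regained by multiplying with
    \<open>p\<close>.\<close>
  have 2: "(\<Sum>j<Suc N. fps2_const (cf F N j) * ?E N j) \<in> mpow N" for N
    by (intro mpow_sum mpow_mult_right mpow_mult_left mpow_power p)
  have 3: "fps2_partial ?E F (Suc N) = (\<Sum>i<N. \<Sum>j<Suc N. fps2_const (cf F i j) * ?E i j) +
     (\<Sum>j<Suc N. fps2_const (cf F N j) * ?E N j)" for N
    by (rule sum.lessThan_Suc)
  show "p * fps2_subst p q F - fps2_partial ?E (fps2_X * F) N \<in> mpow N"
  proof (cases N)
    case (Suc M)
    have "fps2_subst p q F - fps2_partial ?E F (Suc M) \<in> mpow M"
      using fps2_subst_approx[OF p q, of F "Suc M"] by (rule mpow_antimono) simp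
    from mpow_add[OF this 2[of M]]
    have "fps2_subst p q F - (\<Sum>i<M. \<Sum>j<Suc M. fps2_const (cf F i j) * ?E i j) \<in> mpow M"
      unfolding 3 by (simp add: algebra_simps del: sum.lessThan_Suc)
    from mpow_mult[OF p this] show ?thesis
      unfolding Suc 1 by (simp only: right_diff_distrib plus_1_eq_Suc)
  qed simp
qed

lemma fps2_subst_Y_mult:
  assumes p: "p \<in> mpow 1" and q: "q \<in> mpow 1"
  shows "fps2_subst p q (fps2_Y * F) = q * fps2_subst p q F"
proof (rule fps2_subst_eqI[OF p q])
  fix N :: nat
  let ?E = "\<lambda>i j. p ^ i * q ^ j"
  have 1: "fps2_partial ?E (fps2_Y * F) (Suc N) =
    q * (\<Sum>i<Suc N. \<Sum>j<N. fps2_const (cf F i j) * ?E i j)" for N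
    by (subst sum.lessThan_Suc_shift[of _ N])
       (simp add: sum_distrib_left mult_ac del: sum.lessThan_Suc)
  have 2: "(\<Sum>i<Suc N. fps2_const (cf F i N) * ?E i N) \<in> mpow N" for N
    by (intro mpow_sum mpow_mult_right mpow_power q)
  have 3: "fps2_partial ?E F (Suc N) = (\<Sum>i<Suc N. \<Sum>j<N. fps2_const (cf F i j) * ?E i j) +
     (\<Sum>i<Suc N. fps2_const (cf F i N) * ?E i N)" for N
    by (simp only: sum.lessThan_Suc[of _ N] sum.distrib)
  show "q * fps2_subst p q F - fps2_partial ?E (fps2_Y * F) N \<in> mpow N"
  proof (cases N)
    case (Suc M)
    have "fps2_subst p q F - fps2_partial ?E F (Suc M) \<in> mpow M"
      using fps2_subst_approx[OF p q, of F "Suc M"] by (rule mpow_antimono) simp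
    from mpow_add[OF this 2[of M]]
    have "fps2_subst p q F - (\<Sum>i<Suc M. \<Sum>j<M. fps2_const (cf F i j) * ?E i j) \<in> mpow M"
      unfolding 3 by (simp add: algebra_simps del: sum.lessThan_Suc)
    from mpow_mult[OF q this] show ?thesis
      unfolding Suc 1 by (simp only: right_diff_distrib plus_1_eq_Suc)
  qed simp
qed

lemma fps2_subst_X: "p \<in> mpow 1 \<Longrightarrow> q \<in> mpow 1 \<Longrightarrow> fps2_subst p q fps2_X = p"
  using fps2_subst_X_mult[of p q 1] by (simp add: fps2_subst_one)

lemma fps2_subst_Y: "p \<in> mpow 1 \<Longrightarrow> q \<in> mpow 1 \<Longrightarrow> fps2_subst p q fps2_Y = q"
  using fps2_subst_Y_mult[of p q 1] by (simp add: fps2_subst_one)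

text \<open>Identities between continuous maps are proved modulo every power of the maximal ideal, by
  splitting the argument as \<open>c + X F\<^sub>1 + Y F\<^sub>2\<close>.\<close>

lemma fps2_hom_subst:
  fixes p q :: "'k::field fps2"
  assumes p: "p \<in> mpow 1" and q: "q \<in> mpow 1"
  shows "fps2_hom (fps2_subst p q)"
proof
  fix F G :: "'k fps2"
  let ?S = "fps2_subst p q"
  have "\<forall>F. ?S (F * G) - ?S F * ?S G \<in> mpow N" for N
  proof (induction N)
    case (Suc N)
    show ?case
    proof
      fix F :: "'k fps2"
      obtain F1 F2 where F: "F = fps2_const (cf F 0 0) + fps2_X * F1 + fps2_Y * F2"
        by (rule fps2_split)
      have "?S (F * G) - ?S F * ?S G =
        p * (?S (F1 * G) - ?S F1 * ?S G) + q * (?S (F2 * G) - ?S F2 * ?S G)"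
        by (subst (1 2) F)
          (simp add: fps2_subst_add fps2_subst_const_mult distrib_left distrib_right
            right_diff_distrib mult.assoc
            fps2_subst_X_mult[OF p q] fps2_subst_Y_mult[OF p q] fps2_subst_const[OF p q])
      also have "\<dots> \<in> mpow (1 + N)"
        using Suc by (intro mpow_add mpow_mult p q) auto
      finally show "?S (F * G) - ?S F * ?S G \<in> mpow (Suc N)" by simp
    qed
  qed auto
  then show "?S (F * G) = ?S F * ?S G"
    by (intro mpow_eqI) blast
qed (use assms in \<open>auto simp: fps2_subst_add fps2_subst_const\<close>)

text \<open>Continuity of \<open>h\<close> does not enter as an assumption: each induction step uses
  only that \<open>h\<close> is an algebra map, and the gain of one order comes from
  \<open>h p\<close> and \<open>h q\<close>.\<close>

lemma (in fps2_hom) apply_subst: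
  assumes p: "p \<in> mpow 1" and q: "q \<in> mpow 1" and hp: "h p \<in> mpow 1" and hq: "h q \<in> mpow 1"
  shows "h (fps2_subst p q F) = fps2_subst (h p) (h q) F"
proof -
  let ?S = "fps2_subst p q" and ?T = "fps2_subst (h p) (h q)"
  have "\<forall>F. h (?S F) - ?T F \<in> mpow N" for N
  proof (induction N)
    case (Suc N)
    show ?case
    proof
      fix F :: "'k fps2"
      obtain F1 F2 where F: "F = fps2_const (cf F 0 0) + fps2_X * F1 + fps2_Y * F2"
        by (rule fps2_split)
      have "h (?S F) - ?T F = h p * (h (?S F1) - ?T F1) + h q * (h (?S F2) - ?T F2)"
        by (subst (1 2) F)
          (simp add: fps2_subst_add add mult right_diff_distrib fps2_subst_const[OF p q]
            fps2_subst_X_mult[OF p q] fps2_subst_Y_mult[OF p q] fps2_subst_const[OF hp hq]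
            fps2_subst_X_mult[OF hp hq] fps2_subst_Y_mult[OF hp hq])
      also have "\<dots> \<in> mpow (1 + N)"
        using Suc by (intro mpow_add mpow_mult hp hq) auto
      finally show "h (?S F) - ?T F \<in> mpow (Suc N)" by simp
    qed
  qed auto
  then show ?thesis
    by (intro mpow_eqI) blast
qed

lemma fps2_subst_X_Y: "fps2_subst fps2_X fps2_Y F = F"
proof -
  let ?S = "fps2_subst fps2_X fps2_Y"
  have m: "fps2_X \<in> mpow 1" "(fps2_Y :: 'a fps2) \<in> mpow 1" by simp_all
  have "\<forall>F :: 'a fps2. ?S F - F \<in> mpow N" for N
  proof (induction N)
    case (Suc N)
    show ?case
    proof
      fix F :: "'a fps2"
      obtain F1 F2 where F: "F = fps2_const (cf F 0 0) + fps2_X * F1 + fps2_Y * F2"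
        by (rule fps2_split)
      have "?S F - F = fps2_X * (?S F1 - F1) + fps2_Y * (?S F2 - F2)"
        by (subst (1 2) F)
          (simp add: fps2_subst_add right_diff_distrib fps2_subst_const
            fps2_subst_X_mult fps2_subst_Y_mult)
      also have "\<dots> \<in> mpow (1 + N)"
        using Suc by (intro mpow_add mpow_mult m) auto
      finally show "?S F - F \<in> mpow (Suc N)" by simp
    qed
  qed auto
  then show ?thesis
    by (intro mpow_eqI) blast
qed

lemma fps2_subst_Y_X_involution: "fps2_subst fps2_Y fps2_X (fps2_subst fps2_Y fps2_X F) = F"
proof -
  interpret fps2_hom "fps2_subst fps2_Y fps2_X" by (rule fps2_hom_subst) simp_all
  show ?thesis
    by (simp add: apply_subst fps2_subst_X fps2_subst_Y fps2_subst_X_Y)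
qed

text \<open>Elements outside the maximal ideal are units, and an automorphism reflects units. This
  makes an abstract automorphism compatible with substitution.\<close>

lemma fps2_hom_local:
  assumes "fps2_hom h" "surj h" "inj h" "f \<in> mpow 1"
  shows "h f \<in> mpow 1"
proof (rule ccontr)
  interpret fps2_hom h by fact
  assume "h f \<notin> mpow 1"
  then have "cf (h f) 0 0 \<noteq> 0" by (simp add: mpow_1_iff)
  then obtain g where "h f * g = 1" by (rule fps2_unit)
  moreover obtain g' where "g = h g'" using \<open>surj h\<close> by blast
  ultimately have "h (f * g') = h 1" by (simp add: mult)
  then have "f * g' = 1" by (rule injD[OF \<open>inj h\<close>])
  then have "cf (f * g') 0 0 = 1" by simp
  moreover have "cf (f * g') 0 0 = 0"
    using mpow_mult_left[OF assms(4), of g'] by (simp add: mpow_1_iff)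
  ultimately show False by simp
qed

subsection \<open>A power series ring as a free module of rank four\<close>

lemma monic_at_X: "monic_at 1 0 fps2_X" and monic_at_Y: "monic_at 0 1 fps2_Y"
  by (auto simp: monic_at_def exp_rank_less_iff fps_X_def fps_const_def)

lemma sum_lessThan_double:
  fixes f :: "nat \<Rightarrow> 'a::comm_monoid_add"
  shows "(\<Sum>i<2*N. f i) = (\<Sum>i<N. f (2*i) + f (Suc (2*i)))"
  by (induction N) (simp_all add: add.assoc)

text \<open>This is \<open>c0 + c1 X + c2 Y + c3 X Y\<close> with every \<open>ci\<close> evaluated
  at the squares of \<open>X\<close> and \<open>Y\<close>.\<close>

definition parity_join :: "'k::comm_ring_1 fps2 \<Rightarrow> 'k fps2 \<Rightarrow> 'k fps2 \<Rightarrow> 'k fps2 \<Rightarrow> 'k fps2"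
  where "parity_join c0 c1 c2 c3 = Abs_fps (\<lambda>i. Abs_fps (\<lambda>j.
    cf (if even i then if even j then c0 else c2 else if even j then c1 else c3) (i div 2) (j div 2)))"

lemma parity_join_surj:
  obtains c0 c1 c2 c3 where "c = parity_join c0 c1 c2 c3"
proof
  define part where "part d e = Abs_fps (\<lambda>i. Abs_fps (\<lambda>j. cf c (2*i+d) (2*j+e)))" for d e
  show "c = parity_join (part 0 0) (part 1 0) (part 0 1) (part 1 1)"
    by (rule fps2_eqI) (auto simp: parity_join_def part_def elim!: evenE oddE)
qed

lemma parity_join_eq_0:
  assumes "parity_join c0 c1 c2 c3 = 0"
  shows "c0 = 0 \<and> c1 = 0 \<and> c2 = 0 \<and> c3 = 0"
proof -
  have *: "cf (parity_join c0 c1 c2 c3) i j = 0" for i j by (simp add: assms)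
  show ?thesis
    using *[of "2 * i" "2 * j" for i j] *[of "2 * i + 1" "2 * j" for i j]
      *[of "2 * i" "2 * j + 1" for i j] *[of "2 * i + 1" "2 * j + 1" for i j]
    by (auto simp: parity_join_def intro!: fps2_eqI)
qed

locale norm_parameters =
  fixes x y :: "'k::field fps2"
  assumes x: "monic_at 2 0 x" and y: "monic_at 0 2 y"
begin

text \<open>The monomial with exponents \<open>i, j\<close> in which each full square of a variable
  is replaced by \<open>x\<close> or \<open>y\<close>. The leading exponent is still
  \<open>(i, j)\<close>, so the family is triangular.\<close>

definition basis :: "nat \<Rightarrow> nat \<Rightarrow> 'k fps2"
  where "basis i j = x ^ (i div 2) * y ^ (j div 2) * (fps2_X ^ (i mod 2) * fps2_Y ^ (j mod 2))"

lemma monic_at_basis: "monic_at i j (basis i j)"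
proof -
  have "monic_at (i div 2 * 2 + j div 2 * 0 + (i mod 2 * 1 + j mod 2 * 0))
     (i div 2 * 0 + j div 2 * 2 + (i mod 2 * 0 + j mod 2 * 1)) (basis i j)"
    unfolding basis_def
    by (intro monic_at_mult monic_at_power x y monic_at_X monic_at_Y)
  then show ?thesis by simp
qed

lemma params_mpow: "x \<in> mpow 1" "y \<in> mpow 1"
  using monic_at_mpow[OF x] monic_at_mpow[OF y] by (auto intro: mpow_antimono)

text \<open>Grouping the terms by parity translates the bijectivity of
  \<open>fps2_series basis\<close> into freeness with basis 1, X, Y, XY.\<close>

lemma series_basis:
  "fps2_series basis (parity_join c0 c1 c2 c3) = fps2_subst x y c0 + fps2_subst x y c1 * fps2_X +
    fps2_subst x y c2 * fps2_Y + fps2_subst x y c3 * (fps2_X * fps2_Y)"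
proof (rule fps2_series_unique)
  show "basis i j \<in> mpow (i + j)" for i j
    using monic_at_mpow[OF monic_at_basis] .
  fix N
  let ?P = "\<lambda>F. fps2_partial (\<lambda>i j. x ^ i * y ^ j) F N" and ?S = "fps2_subst x y"
  have "fps2_partial basis (parity_join c0 c1 c2 c3) (2 * N) =
     ?P c0 + ?P c1 * fps2_X + ?P c2 * fps2_Y + ?P c3 * (fps2_X * fps2_Y)"
    by (simp add: sum_lessThan_double parity_join_def basis_def sum.distrib)
       (simp add: sum_distrib_left sum_distrib_right mult_ac add_ac)
  then have "?S c0 + ?S c1 * fps2_X + ?S c2 * fps2_Y + ?S c3 * (fps2_X * fps2_Y)
      - fps2_partial basis (parity_join c0 c1 c2 c3) (2 * N) =
     (?S c0 - ?P c0) + (?S c1 - ?P c1) * fps2_X + (?S c2 - ?P c2) * fps2_Y +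
     (?S c3 - ?P c3) * (fps2_X * fps2_Y)"
    by (simp add: left_diff_distrib)
  also have "\<dots> \<in> mpow N"
    by (intro mpow_add mpow_mult_left fps2_subst_approx params_mpow)
  finally show "\<exists>M\<ge>N. ?S c0 + ?S c1 * fps2_X + ?S c2 * fps2_Y + ?S c3 * (fps2_X * fps2_Y)
      - fps2_partial basis (parity_join c0 c1 c2 c3) M \<in> mpow N"
    by (intro exI[of _ "2 * N"]) auto
qed

lemma basis_span:
  "\<exists>c0 c1 c2 c3. f = fps2_subst x y c0 + fps2_subst x y c1 * fps2_X +
    fps2_subst x y c2 * fps2_Y + fps2_subst x y c3 * (fps2_X * fps2_Y)"
proof -
  obtain c where "fps2_series basis c = f"
    using fps2_series_bij[of basis] monic_at_basis by (metis bij_pointE)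
  moreover obtain c0 c1 c2 c3 where "c = parity_join c0 c1 c2 c3" by (rule parity_join_surj)
  ultimately show ?thesis using series_basis by metis
qed

lemma basis_independent:
  assumes "fps2_subst x y c0 + fps2_subst x y c1 * fps2_X +
    fps2_subst x y c2 * fps2_Y + fps2_subst x y c3 * (fps2_X * fps2_Y) = 0"
  shows "c0 = 0 \<and> c1 = 0 \<and> c2 = 0 \<and> c3 = 0"
proof (rule parity_join_eq_0)
  have "inj (fps2_series basis)" using fps2_series_bij[of basis] monic_at_basis by (simp add: bij_is_inj)
  moreover have "fps2_series basis (parity_join c0 c1 c2 c3) = fps2_series basis 0"
    unfolding series_basis assms by (rule fps2_eqI) (simp add: fps2_series_def)
  ultimately show "parity_join c0 c1 c2 c3 = 0" by (rule injD)
qed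

end

subsection \<open>Saturated submodules of rank one\<close>

text \<open>A generator is an element whose constant coefficient with respect to \<open>fps2_X\<close> has minimal
  order in \<open>k[[y]]\<close>; this replaces the division by a greatest common divisor in the factorial
  ring \<open>k[[x,y]]\<close>.\<close>

lemma saturated_rank_one_cyclic:
  fixes W :: "('i \<Rightarrow> 'k::field fps2) set"
  assumes diff: "\<And>v w. v \<in> W \<Longrightarrow> w \<in> W \<Longrightarrow> (\<lambda>i. v i - w i) \<in> W"
    and smult: "\<And>c w. w \<in> W \<Longrightarrow> (\<lambda>i. c * w i) \<in> W"
    and saturated: "\<And>w. (\<lambda>i. fps2_X * w i) \<in> W \<Longrightarrow> w \<in> W"
    and minors: "\<And>v w i j. v \<in> W \<Longrightarrow> w \<in> W \<Longrightarrow> v i * w j = v j * w i"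
    and nontrivial: "w1 \<in> W" "w1 i1 \<noteq> 0"
  obtains w i where "w \<in> W" "w i \<noteq> 0" "\<And>v. v \<in> W \<Longrightarrow> \<exists>c. \<forall>i. v i = c * w i"
proof -
  \<comment> \<open>Saturation is what keeps the quotient by \<open>fps2_X\<close> inside
    \<open>W\<close>.\<close>
  have divide: "\<exists>v\<in>W. \<forall>i. w i = fps2_X * v i" if "w \<in> W" "\<And>i. fps_nth (w i) 0 = 0" for w
  proof
    show eq: "\<forall>i. w i = fps2_X * fps_shift 1 (w i)"
      using that(2) by (auto simp: fps_eq_iff gr0_conv_Suc)
    have "(\<lambda>i. fps2_X * fps_shift 1 (w i)) = w" by (intro ext) (rule eq[rule_format, symmetric])
    then show "(\<lambda>i. fps_shift 1 (w i)) \<in> W" using that(1) by (subst saturated) simp_all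
  qed
  \<comment> \<open>Cancelling \<open>fps2_X\<close> repeatedly must stop, because a nonzero
    component has a nonzero coefficient at some finite index.\<close>
  have "\<exists>w\<in>W. \<exists>i. fps_nth (w i) 0 \<noteq> 0"
  proof -
    have "\<exists>w\<in>W. \<exists>i. fps_nth (w i) 0 \<noteq> 0" if "w \<in> W" "fps_nth (w i) n \<noteq> 0" for w i n
      using that
    proof (induction n arbitrary: w)
      case (Suc n)
      show ?case
      proof (cases "\<forall>i. fps_nth (w i) 0 = 0")
        case True
        then obtain v where v: "v \<in> W" "\<forall>i. w i = fps2_X * v i" using divide Suc.prems by blast
        then have "fps_nth (v i) n \<noteq> 0" using Suc.prems(2) by simp
        then show ?thesis by (rule Suc.IH[OF v(1)])
      qed (use Suc in auto)
    qed auto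
    moreover obtain n where "fps_nth (w1 i1) n \<noteq> 0" using nontrivial(2) by (auto simp: fps_eq_iff)
    ultimately show ?thesis using nontrivial(1) by blast
  qed
  then obtain v i where "v \<in> W \<and> fps_nth (v i) 0 \<noteq> 0" by blast
  then obtain w i0 where w: "w \<in> W" "fps_nth (w i0) 0 \<noteq> 0"
    and min: "\<And>v i. v \<in> W \<Longrightarrow> fps_nth (v i) 0 \<noteq> 0 \<Longrightarrow>
      subdegree (fps_nth (w i0) 0) \<le> subdegree (fps_nth (v i) 0)"
    using ex_has_least_nat[of "\<lambda>(w, i). w \<in> W \<and> fps_nth (w i) 0 \<noteq> 0" "(v, i)"
      "\<lambda>(w, i). subdegree (fps_nth (w i) 0)"] by auto
  \<comment> \<open>Modulo \<open>fps2_X\<close> one works in the discrete valuation ring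
    \<open>k[[y]]\<close>. Minimality of the order provides the quotient \<open>d\<close> in
    component \<open>i0\<close>, and the vanishing minors carry the same \<open>d\<close> to all
    components.\<close>
  have lead: "\<exists>d. \<forall>j. fps_nth (v j) 0 = d * fps_nth (w j) 0" if v: "v \<in> W" for v
  proof -
    have "fps_nth (w i0) 0 dvd fps_nth (v i0) 0"
      using min[OF v, of i0] w(2) by (cases "fps_nth (v i0) 0 = 0") (auto simp: fps_dvd_iff)
    then obtain d where d: "fps_nth (v i0) 0 = fps_nth (w i0) 0 * d" by (rule dvdE)
    have "fps_nth (v j) 0 = d * fps_nth (w j) 0" for j
    proof -
      have "fps_nth (v i0 * w j) 0 = fps_nth (v j * w i0) 0"
        using minors[OF v w(1)] by simp
      then have "fps_nth (w i0) 0 * (d * fps_nth (w j) 0) = fps_nth (w i0) 0 * fps_nth (v j) 0"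
        by (simp add: d mult_ac)
      then show ?thesis using w(2) by simp
    qed
    then show ?thesis by blast
  qed
  have "\<exists>d v'. v' \<in> W \<and> (\<forall>j. v j = fps_const d * w j + fps2_X * v' j)" if v: "v \<in> W" for v
  proof -
    obtain d where d: "\<forall>j. fps_nth (v j) 0 = d * fps_nth (w j) 0" using lead[OF v] by blast
    obtain v' where "v' \<in> W" "\<forall>j. v j - fps_const d * w j = fps2_X * v' j"
      using divide[OF diff[OF v smult[OF w(1), of "fps_const d"]]] d by auto
    then show ?thesis by (metis add.commute diff_add_cancel)
  qed
  then obtain d nx where nx: "nx v \<in> W" and
    step: "v j = fps_const (d v) * w j + fps2_X * nx v j" if "v \<in> W" for v j
    by metis
  \<comment> \<open>The quotient of \<open>v\<close> by \<open>w\<close>, digit by digit: its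
    coefficient at \<open>n\<close> is the leading quotient of the \<open>n\<close>-th
    remainder.\<close>
  define C where "C v = Abs_fps (\<lambda>n. d ((nx ^^ n) v))" for v
  have C: "C v = fps_const (d v) + fps2_X * C (nx v)" for v
  proof (rule fps_ext)
    fix n show "fps_nth (C v) n = fps_nth (fps_const (d v) + fps2_X * C (nx v)) n"
      by (cases n) (simp_all add: C_def funpow_Suc_right del: funpow.simps)
  qed
  have "fps_nth (v j - C v * w j) n = 0" if "v \<in> W" for v j n
    using that
  proof (induction n arbitrary: v)
    case 0
    have "v j - C v * w j = fps2_X * (nx v j - C (nx v) * w j)"
      by (subst C, subst step[OF 0]) (simp add: algebra_simps)
    then show ?case by simp
  next
    case (Suc n)
    have "v j - C v * w j = fps2_X * (nx v j - C (nx v) * w j)"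
      by (subst C, subst step[OF Suc.prems]) (simp add: algebra_simps)
    then show ?case using Suc.IH[OF nx[OF Suc.prems]] by simp
  qed
  then have "v j - C v * w j = 0" if "v \<in> W" for v j
    using that by (intro fps_ext) simp
  then have "\<exists>c. \<forall>j. v j = c * w j" if "v \<in> W" for v
    using that by (intro exI[of _ "C v"]) simp
  moreover have "w i0 \<noteq> 0" using w(2) by auto
  ultimately show ?thesis using that w(1) by blast
qed

subsection \<open>The module of invariants\<close>

text \<open>\<psi> embeds R = k[[x,y]] into A, and 1, \<open>z\<close> form a basis of the
  invariants over its image. The independence clause with \<open>b = 0\<close> contains the
  injectivity of \<psi>.\<close>

definition invariants_basis ::
    "('k::field fps2 \<Rightarrow> 'k fps2) \<Rightarrow> ('k fps2 \<Rightarrow> 'k fps2) \<Rightarrow> 'k fps2 \<Rightarrow> bool"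
  where "invariants_basis \<sigma> \<psi> z \<longleftrightarrow> fps2_hom \<psi> \<and>
    (\<forall>a b. \<psi> a + \<psi> b * z = 0 \<longrightarrow> a = 0 \<and> b = 0) \<and>
    (\<forall>f. \<sigma> f = f \<longleftrightarrow> (\<exists>a b. f = \<psi> a + \<psi> b * z))"

text \<open>These are the components of the triple product n x (u x v) = u (n . v) - v (n . u) for n
  = (a, b, c), whose right-hand side vanishes when n is orthogonal to u and v.\<close>

lemma cross_product_orthogonal:
  fixes a b c :: "'a::comm_ring_1"
  assumes "u0 * a + u1 * b + u2 * c = 0" "v0 * a + v1 * b + v2 * c = 0"
  shows "a * (u2 * v0 - u0 * v2) = b * (u1 * v2 - u2 * v1)"
    and "a * (u0 * v1 - u1 * v0) = c * (u1 * v2 - u2 * v1)"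
    and "b * (u0 * v1 - u1 * v0) = c * (u2 * v0 - u0 * v2)"
proof -
  let ?u = "u0 * a + u1 * b + u2 * c" and ?v = "v0 * a + v1 * b + v2 * c"
  have "a * (u2 * v0 - u0 * v2) - b * (u1 * v2 - u2 * v1) = u2 * ?v - v2 * ?u"
    "a * (u0 * v1 - u1 * v0) - c * (u1 * v2 - u2 * v1) = v1 * ?u - u1 * ?v"
    "b * (u0 * v1 - u1 * v0) - c * (u2 * v0 - u0 * v2) = u0 * ?v - v0 * ?u"
    by (simp_all add: algebra_simps)
  then show "a * (u2 * v0 - u0 * v2) = b * (u1 * v2 - u2 * v1)"
    "a * (u0 * v1 - u1 * v0) = c * (u1 * v2 - u2 * v1)"
    "b * (u0 * v1 - u1 * v0) = c * (u2 * v0 - u0 * v2)"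
    using assms by simp_all
qed

lemma char_2_double: "CHAR('a::ring_1) = 2 \<Longrightarrow> a + a = (0 :: 'a)"
  using of_nat_CHAR[where ?'a = 'a] by (metis mult_2 mult_zero_left of_nat_numeral)

lemma fps2_char_2: "CHAR('k::field) = 2 \<Longrightarrow> f + f = (0 :: 'k fps2)"
  by (rule fps2_eqI) (simp add: char_2_double)

text \<open>In the coordinates \<open>w 0, w 1, w 2\<close> of A/R with respect to
  \<open>u, v, u * v\<close>, the map \<sigma> - 1 is the R-linear form with coefficients
  \<open>a, b, c\<close>, and \<open>W\<close> is its kernel. The work lies in showing that
  \<open>W\<close> has rank exactly one.\<close>

lemma invariants_basis_exists:
  fixes \<sigma> \<psi> :: "'k::field fps2 \<Rightarrow> 'k fps2"
  assumes char: "CHAR('k) = 2" and "fps2_hom \<sigma>" and invol: "\<And>f. \<sigma> (\<sigma> f) = f"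
    and "fps2_hom \<psi>" and inv: "\<And>a. \<sigma> (\<psi> a) = \<psi> a" and nid: "\<sigma> f0 \<noteq> f0"
    and span: "\<And>f. \<exists>c0 c1 c2 c3. f = \<psi> c0 + \<psi> c1 * u + \<psi> c2 * v + \<psi> c3 * (u * v)"
    and indep: "\<And>c0 c1 c2 c3. \<psi> c0 + \<psi> c1 * u + \<psi> c2 * v + \<psi> c3 * (u * v) = 0 \<Longrightarrow>
      c0 = 0 \<and> c1 = 0 \<and> c2 = 0 \<and> c3 = 0"
    and u: "u * \<sigma> u = \<psi> x" "x \<noteq> 0" and v: "v * \<sigma> v = \<psi> y" "y \<noteq> 0"
  shows "\<exists>z. invariants_basis \<sigma> \<psi> z"
proof -
  interpret \<sigma>: fps2_hom \<sigma> by fact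
  interpret \<psi>: fps2_hom \<psi> by fact
  define a b c where abc: "a = \<sigma> u - u" "b = \<sigma> v - v" "c = \<sigma> (u * v) - u * v"
  \<comment> \<open>Two forms of the product rule for \<sigma> - 1: the first allows cancellation of
    \<open>a\<close>, the second of \<open>b\<close>, whichever is nonzero.\<close>
  have c1: "c = a * \<sigma> v + u * b" and c2: "c = b * \<sigma> u + v * a"
    by (simp_all add: abc \<sigma>.mult algebra_simps)
  define V where "V w = \<psi> (w 0) * u + \<psi> (w 1) * v + \<psi> (w 2) * (u * v)" for w :: "nat \<Rightarrow> 'k fps2"
  define W where "W = {w :: nat \<Rightarrow> 'k fps2. (\<forall>i>2. w i = 0) \<and> \<sigma> (V w) = V w}"
  have V_inv: "\<sigma> (V w) = V w \<longleftrightarrow> \<psi> (w 0) * a + \<psi> (w 1) * b + \<psi> (w 2) * c = 0" for w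
  proof -
    have "\<sigma> (V w) - V w = \<psi> (w 0) * a + \<psi> (w 1) * b + \<psi> (w 2) * c"
      by (simp add: V_def abc \<sigma>.mult \<sigma>.add inv algebra_simps)
    then show ?thesis by (metis eq_iff_diff_eq_0)
  qed
  have V_diff: "V (\<lambda>i. w i - w' i) = V w - V w'" for w w'
    by (simp add: V_def \<psi>.diff algebra_simps)
  have V_smult: "V (\<lambda>i. r * w i) = \<psi> r * V w" for r w
    by (simp add: V_def \<psi>.mult algebra_simps)
  have \<psi>_inj: "r = 0" if "\<psi> r = 0" for r using indep[of r 0 0 0] that by simp
  have span3: "\<exists>r w. f = \<psi> r + V w \<and> (\<forall>i>2. w i = 0)" for f
  proof -
    obtain r0 r1 r2 r3 where f: "f = \<psi> r0 + \<psi> r1 * u + \<psi> r2 * v + \<psi> r3 * (u * v)"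
      using span by blast
    show ?thesis
      by (intro exI[of _ r0] exI[of _ "\<lambda>i. if i = 0 then r1 else if i = 1 then r2
        else if i = 2 then r3 else 0"]) (simp add: V_def f)
  qed
  have ab: "a \<noteq> 0 \<or> b \<noteq> 0"
  proof (rule ccontr)
    assume *: "\<not> ?thesis"
    then have "\<sigma> (V w) = V w" for w unfolding V_inv c1 by simp
    moreover obtain r w where "f0 = \<psi> r + V w" using span3 by blast
    ultimately show False using nid by (simp add: \<sigma>.add inv)
  qed
  \<comment> \<open>No nonzero vector over R is parallel to \<open>(a, b, c)\<close>. For nonzero
    \<open>a\<close>, cancelling it expresses \<open>\<psi> r2\<close> through
    \<open>\<sigma> v\<close> and \<open>u\<close>; multiplication by \<open>v\<close> replaces
    \<open>\<sigma> v\<close> by the norm and leaves an R-linear relation among 1, \<open>u\<close>,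
    \<open>v\<close>, \<open>u * v\<close>.\<close>
  have c_zero: "\<psi> r0 = 0 \<and> \<psi> r1 = 0 \<and> \<psi> r2 = 0"
    if "a * \<psi> r1 = b * \<psi> r0" "a * \<psi> r2 = c * \<psi> r0" "b * \<psi> r2 = c * \<psi> r1" for r0 r1 r2
  proof (cases "a = 0")
    case False
    have "a * \<psi> r2 = a * (\<sigma> v * \<psi> r0 + u * \<psi> r1)"
      using that(1,2) by (simp add: c1 algebra_simps)
    then have "\<psi> r2 = \<sigma> v * \<psi> r0 + u * \<psi> r1" using False by simp
    then have "v * \<psi> r2 = (v * \<sigma> v) * \<psi> r0 + u * v * \<psi> r1" by (simp add: algebra_simps)
    then have "\<psi> (- y * r0) + \<psi> 0 * u + \<psi> r2 * v + \<psi> (- r1) * (u * v) = 0"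
      by (simp add: v(1) \<psi>.mult \<psi>.uminus algebra_simps)
    from indep[OF this] show ?thesis using v(2) by simp
  next
    case True
    then have False: "b \<noteq> 0" using ab by simp
    have "b * \<psi> r2 = b * (\<sigma> u * \<psi> r1 + v * \<psi> r0)"
      using that(1,3) by (simp add: c2 algebra_simps)
    then have "\<psi> r2 = \<sigma> u * \<psi> r1 + v * \<psi> r0" using False by simp
    then have "u * \<psi> r2 = (u * \<sigma> u) * \<psi> r1 + u * v * \<psi> r0" by (simp add: algebra_simps)
    then have "\<psi> (- x * r1) + \<psi> r2 * u + \<psi> 0 * v + \<psi> (- r0) * (u * v) = 0"
      by (simp add: u(1) \<psi>.mult \<psi>.uminus algebra_simps)
    from indep[OF this] show ?thesis using u(2) by simp
  qed
  have minors: "w i * w' j = w j * w' i" if W: "w \<in> W" "w' \<in> W" for w w' i j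
  proof -
    \<comment> \<open>The cross product of two kernel vectors is parallel to
      \<open>(a, b, c)\<close>, hence zero.\<close>
    define r0 r1 r2 where r: "r0 = w 1 * w' 2 - w 2 * w' 1" "r1 = w 2 * w' 0 - w 0 * w' 2"
      "r2 = w 0 * w' 1 - w 1 * w' 0"
    have 1: "\<psi> (w 0) * a + \<psi> (w 1) * b + \<psi> (w 2) * c = 0"
      and 2: "\<psi> (w' 0) * a + \<psi> (w' 1) * b + \<psi> (w' 2) * c = 0"
      using W unfolding W_def V_inv by auto
    have "a * \<psi> r1 = b * \<psi> r0" "a * \<psi> r2 = c * \<psi> r0" "b * \<psi> r2 = c * \<psi> r1"
      unfolding r \<psi>.diff \<psi>.mult using cross_product_orthogonal[OF 1 2] by simp_all
    then have "r0 = 0" "r1 = 0" "r2 = 0" using c_zero \<psi>_inj by blast+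
    then have r': "w 1 * w' 2 = w 2 * w' 1" "w 2 * w' 0 = w 0 * w' 2" "w 0 * w' 1 = w 1 * w' 0"
      by (simp_all add: r)
    have out: "w i = 0" "w' i = 0" if "i \<notin> {0,1,2}" for i
      using W that unfolding W_def by auto
    show ?thesis
      using r' out[of i] out[of j] by (cases "i \<in> {0,1,2}"; cases "j \<in> {0,1,2}") auto
  qed
  \<comment> \<open>If \<open>W\<close> were zero, every invariant would lie in R. In characteristic
    2 this applies to \<open>a\<close> and \<open>b\<close>, and the trivial syzygy
    \<open>(b, -a, 0)\<close> would then be a nonzero element of \<open>W\<close>.\<close>
  have "\<exists>w\<in>W. \<exists>i. w i \<noteq> 0"
  proof (rule ccontr)
    assume *: "\<not> ?thesis"
    have range: "\<exists>r. f = \<psi> r" if f: "\<sigma> f = f" for f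
    proof -
      obtain r w where rw: "f = \<psi> r + V w" "\<forall>i>2. w i = 0" using span3 by blast
      then have "w \<in> W" using f by (simp add: W_def \<sigma>.add inv)
      then have "w i = 0" for i using * by blast
      then have "V w = 0" by (simp add: V_def)
      then show ?thesis using rw by auto
    qed
    have neg: "- f = f" for f :: "'k fps2"
      using fps2_char_2[OF char, of f] by (simp add: eq_neg_iff_add_eq_0)
    have "\<sigma> a = a" "\<sigma> b = b"
      using neg[of a] neg[of b] by (simp_all add: abc \<sigma>.diff invol)
    then obtain a' b' where ab': "a = \<psi> a'" "b = \<psi> b'" using range by blast
    define w where "w = (\<lambda>i :: nat. if i = 0 then b' else if i = 1 then - a' else 0)"
    have "w \<in> W"
      unfolding W_def mem_Collect_eq V_inv by (simp add: w_def \<psi>.uminus ab' mult.commute)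
    then have w0: "w i = 0" for i using * by blast
    have "a' = 0" "b' = 0" using w0[of 0] w0[of 1] by (simp_all add: w_def)
    then show False using ab ab' by simp
  qed
  then obtain w1 i1 where w1: "w1 \<in> W" "w1 i1 \<noteq> 0" by blast
  have W_diff: "(\<lambda>i. w i - w' i) \<in> W" if "w \<in> W" "w' \<in> W" for w w'
    using that unfolding W_def by (simp add: V_diff \<sigma>.diff)
  have W_smult: "(\<lambda>i. r * w i) \<in> W" if "w \<in> W" for r w
    using that unfolding W_def by (simp add: V_smult \<sigma>.mult inv)
  have W_sat: "w \<in> W" if "(\<lambda>i. fps2_X * w i) \<in> W" for w
  proof -
    have "\<psi> fps2_X * \<sigma> (V w) = \<psi> fps2_X * V w"
      using that unfolding W_def by (simp add: V_smult \<sigma>.mult inv)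
    moreover have "\<psi> fps2_X \<noteq> 0" using \<psi>_inj[of fps2_X] by auto
    moreover have "w i = 0" if "i > 2" for i
      using that \<open>(\<lambda>i. fps2_X * w i) \<in> W\<close> by (simp add: W_def)
    ultimately show ?thesis unfolding W_def by simp
  qed
  obtain w i where w: "w \<in> W" "w i \<noteq> 0" and gen: "\<And>v. v \<in> W \<Longrightarrow> \<exists>c. \<forall>i. v i = c * w i"
    using saturated_rank_one_cyclic[of W, OF W_diff W_smult W_sat minors w1] by metis
  have "invariants_basis \<sigma> \<psi> (V w)"
    unfolding invariants_basis_def
  proof (intro conjI allI impI)
    fix f
    show "\<sigma> f = f \<longleftrightarrow> (\<exists>r s. f = \<psi> r + \<psi> s * V w)"
    proof
      assume f: "\<sigma> f = f"
      obtain r w' where rw: "f = \<psi> r + V w'" "\<forall>i>2. w' i = 0" using span3 by blast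
      then have "w' \<in> W" using f by (simp add: W_def \<sigma>.add inv)
      then obtain s where "\<forall>i. w' i = s * w i" using gen by blast
      then have "w' = (\<lambda>i. s * w i)" by auto
      then show "\<exists>r s. f = \<psi> r + \<psi> s * V w" using rw(1) V_smult by metis
    next
      assume "\<exists>r s. f = \<psi> r + \<psi> s * V w"
      then show "\<sigma> f = f" using w(1) by (auto simp: \<sigma>.add \<sigma>.mult inv W_def)
    qed
  next
    fix r s assume "\<psi> r + \<psi> s * V w = 0"
    then have "\<psi> r + \<psi> (s * w 0) * u + \<psi> (s * w 1) * v + \<psi> (s * w 2) * (u * v) = 0"
      by (simp add: V_def \<psi>.mult algebra_simps)
    from indep[OF this] have *: "r = 0" "s * w 0 = 0" "s * w 1 = 0" "s * w 2 = 0" by auto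
    show "r = 0" by fact
    have "\<not> 2 < i" using w unfolding W_def by blast
    then consider "i = 0" | "i = 1" | "i = 2" by linarith
    then show "s = 0" using * w(2) by cases auto
  qed fact
  then show ?thesis by blast
qed

subsection \<open>Involutions in characteristic two\<close>

lemma invariants_basis_monic:
  fixes \<sigma> :: "'k::field fps2 \<Rightarrow> 'k fps2"
  assumes char: "CHAR('k) = 2" and "fps2_hom \<sigma>" and invol: "\<And>f. \<sigma> (\<sigma> f) = f" and nid: "\<sigma> f0 \<noteq> f0"
    and X: "monic_at 1 0 (\<sigma> fps2_X)" and Y: "monic_at 0 1 (\<sigma> fps2_Y)"
  shows "\<exists>\<psi> z. invariants_basis \<sigma> \<psi> z"
proof -
  interpret \<sigma>: fps2_hom \<sigma> by fact
  define x y where xy: "x = fps2_X * \<sigma> fps2_X" "y = fps2_Y * \<sigma> fps2_Y"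
  interpret norm_parameters x y
  proof
    show "monic_at 2 0 x" "monic_at 0 2 y"
      using monic_at_mult[OF monic_at_X X] monic_at_mult[OF monic_at_Y Y]
      by (simp_all add: xy numeral_2_eq_2)
  qed
  have inv: "\<sigma> x = x" "\<sigma> y = y" by (simp_all add: xy \<sigma>.mult invol mult.commute)
  let ?\<psi> = "fps2_subst x y"
  have "\<exists>z. invariants_basis \<sigma> ?\<psi> z"
  proof (rule invariants_basis_exists[OF char _ invol])
    show "\<sigma> (?\<psi> a) = ?\<psi> a" for a
      using \<sigma>.apply_subst[of x y a] params_mpow by (simp add: inv)
    \<comment> \<open>The norms are the images of the two coordinates of R, so those coordinates
      serve as the nonzero \<open>x\<close> and \<open>y\<close> of the general statement.\<close>
    show "fps2_X * \<sigma> fps2_X = ?\<psi> fps2_X" "fps2_Y * \<sigma> fps2_Y = ?\<psi> fps2_Y"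
      using params_mpow by (simp_all add: fps2_subst_X fps2_subst_Y flip: xy)
    show "fps2_hom ?\<psi>" by (intro fps2_hom_subst params_mpow)
    show "(fps2_X :: 'k fps2) \<noteq> 0" "(fps2_Y :: 'k fps2) \<noteq> 0" by simp_all
  qed (fact basis_span basis_independent nid \<open>fps2_hom \<sigma>\<close>)+
  then show ?thesis by blast
qed

text \<open>Permits a change of coordinates: \<theta> carries the fixed elements of the conjugate
  onto those of \<sigma>.\<close>

lemma invariants_basis_conjugate:
  assumes \<theta>: "fps2_hom \<theta>" "bij \<theta>"
    and \<psi>: "invariants_basis (\<lambda>f. inv_into UNIV \<theta> (\<sigma> (\<theta> f))) \<psi> z"
  shows "invariants_basis \<sigma> (\<lambda>f. \<theta> (\<psi> f)) (\<theta> z)"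
  unfolding invariants_basis_def
proof (intro conjI allI impI)
  interpret \<theta>: fps2_hom \<theta> by fact
  let ?\<tau> = "inv_into UNIV \<theta>"
  have \<theta>\<tau>: "\<theta> (?\<tau> f) = f" for f using \<theta>(2) by (simp add: bij_is_surj surj_f_inv_f)
  have \<tau>\<theta>: "?\<tau> (\<theta> f) = f" for f using \<theta>(2) by (simp add: bij_is_inj)
  show "fps2_hom (\<lambda>f. \<theta> (\<psi> f))" using \<psi> \<theta>(1) by (simp add: invariants_basis_def fps2_hom_comp)
  fix f
  have "\<sigma> f = f \<longleftrightarrow> ?\<tau> (\<sigma> (\<theta> (?\<tau> f))) = ?\<tau> f" by (metis \<theta>\<tau>)
  also have "\<dots> \<longleftrightarrow> (\<exists>a b. ?\<tau> f = \<psi> a + \<psi> b * z)" using \<psi> by (simp add: invariants_basis_def)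
  also have "\<dots> \<longleftrightarrow> (\<exists>a b. f = \<theta> (\<psi> a) + \<theta> (\<psi> b) * \<theta> z)"
    by (metis \<theta>\<tau> \<tau>\<theta> \<theta>.add \<theta>.mult)
  finally show "\<sigma> f = f \<longleftrightarrow> (\<exists>a b. f = \<theta> (\<psi> a) + \<theta> (\<psi> b) * \<theta> z)" .
next
  interpret \<theta>: fps2_hom \<theta> by fact
  fix a b assume "\<theta> (\<psi> a) + \<theta> (\<psi> b) * \<theta> z = 0"
  then have "\<theta> (\<psi> a + \<psi> b * z) = \<theta> 0" by (simp add: \<theta>.add \<theta>.mult)
  then have "\<psi> a + \<psi> b * z = 0" using \<theta>(2) by (metis bij_is_inj injD)
  then have "a = 0 \<and> b = 0"
    using \<psi> unfolding invariants_basis_def by (elim conjE) (drule spec, drule spec, erule mp)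
  then show "a = 0" "b = 0" by simp_all
qed

text \<open>The chain rule at the origin. It holds because a product with one factor in the maximal
  ideal has as linear part the linear part of that factor times the constant term of the other, and
  \<open>h\<close> preserves constant terms.\<close>

lemma (in fps2_hom) linear_coeffs:
  assumes X: "h fps2_X \<in> mpow 1" and Y: "h fps2_Y \<in> mpow 1" and f: "f \<in> mpow 1"
  shows "cf (h f) 1 0 = cf f 1 0 * cf (h fps2_X) 1 0 + cf f 0 1 * cf (h fps2_Y) 1 0"
    and "cf (h f) 0 1 = cf f 1 0 * cf (h fps2_X) 0 1 + cf f 0 1 * cf (h fps2_Y) 0 1"
proof -
  have const_coeff: "cf (h g) 0 0 = cf g 0 0" for g
  proof -
    obtain g1 g2 where "g = fps2_const (cf g 0 0) + fps2_X * g1 + fps2_Y * g2" by (rule fps2_split)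
    then have "h g = fps2_const (cf g 0 0) + (h fps2_X * h g1 + h fps2_Y * h g2)"
      by (metis add mult const add.assoc)
    moreover have "h fps2_X * h g1 + h fps2_Y * h g2 \<in> mpow 1"
      by (intro mpow_add mpow_mult_left X Y)
    ultimately show ?thesis by (simp add: mpow_1_iff cf_const)
  qed
  obtain f1 f2 where f12: "f = fps2_const (cf f 0 0) + fps2_X * f1 + fps2_Y * f2" by (rule fps2_split)
  have f0: "cf f 0 0 = 0" using f by (simp add: mpow_1_iff)
  have fs: "f = fps2_X * f1 + fps2_Y * f2" using f12 by (simp add: f0)
  have hf: "h f = h fps2_X * h f1 + h fps2_Y * h f2" unfolding fs add mult ..
  have c: "cf f 1 0 = cf f1 0 0" "cf f 0 1 = cf f2 0 0" by (subst fs, simp)+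
  have p: "cf (p * q) 1 0 = cf p 1 0 * cf q 0 0" "cf (p * q) 0 1 = cf p 0 1 * cf q 0 0"
    if "p \<in> mpow 1" for p q :: "'k fps2"
    using that by (simp_all add: mpow_1_iff fps2_mult_nth)
  show "cf (h f) 1 0 = cf f 1 0 * cf (h fps2_X) 1 0 + cf f 0 1 * cf (h fps2_Y) 1 0"
    "cf (h f) 0 1 = cf f 1 0 * cf (h fps2_X) 0 1 + cf f 0 1 * cf (h fps2_Y) 0 1"
    unfolding hf fps_add_nth p[OF X] p[OF Y] const_coeff c by (simp_all add: mult.commute)
qed

lemma char_2_square_eq_1:
  fixes a :: "'k::field"
  assumes "CHAR('k) = 2" "a * a = 1" shows "a = 1"
proof -
  have "(a - 1) * (a - 1) = a * a + 1 - (a + a)" by (simp add: algebra_simps)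
  also have "\<dots> = 0" using assms(2) char_2_double[OF assms(1)] by (metis diff_0_right)
  finally show ?thesis by simp
qed

lemma involution_invariants_basis:
  fixes \<sigma> :: "'k::field fps2 \<Rightarrow> 'k fps2"
  assumes char: "CHAR('k) = 2" and \<sigma>: "fps2_hom \<sigma>" and invol: "\<And>f. \<sigma> (\<sigma> f) = f" and nid: "\<sigma> f0 \<noteq> f0"
  shows "\<exists>\<psi> z. invariants_basis \<sigma> \<psi> z"
proof -
  interpret \<sigma>: fps2_hom \<sigma> by fact
  have "bij \<sigma>" using invol by (rule involuntory_imp_bij)
  then have local: "\<sigma> f \<in> mpow 1" if "f \<in> mpow 1" for f
    using fps2_hom_local[OF \<sigma> _ _ that] by (simp add: bij_is_inj bij_is_surj)
  let ?X = "\<sigma> fps2_X" and ?Y = "\<sigma> fps2_Y"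
  have m: "?X \<in> mpow 1" "?Y \<in> mpow 1" using local[of fps2_X] local[of fps2_Y] by simp_all
  show ?thesis
  proof (cases "cf ?X 0 1 = 0")
    case True
    \<comment> \<open>The linear part is triangular, so the diagonal of its square consists of
      squares; for an involution that square is the identity matrix.\<close>
    have "cf (\<sigma> ?X) 1 0 = cf ?X 1 0 * cf ?X 1 0" "cf (\<sigma> ?Y) 0 1 = cf ?Y 0 1 * cf ?Y 0 1"
      using \<sigma>.linear_coeffs[OF m m(1)] \<sigma>.linear_coeffs[OF m m(2)] True by simp_all
    then have "cf ?X 1 0 = 1" "cf ?Y 0 1 = 1"
      by (auto intro: char_2_square_eq_1[OF char] simp: invol)
    then have "monic_at 1 0 ?X" "monic_at 0 1 ?Y"
      using m True by (auto simp: monic_at_def exp_rank_less_iff mpow_1_iff less_Suc_eq)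
    then show ?thesis by (rule invariants_basis_monic[OF char \<sigma> invol nid])
  next
    case False
    text \<open>In the coordinates \<open>u, X\<close> with \<open>u = (\<sigma> X - X) / \<beta>\<close> the involution is linear: it fixes
      \<open>u\<close> and sends \<open>X\<close> to \<open>X + \<beta> u\<close>.\<close>
    define \<beta> where "\<beta> = cf ?X 0 1"
    define u where "u = fps2_const (inverse \<beta>) * (?X - fps2_X)"
    have \<beta>: "\<beta> \<noteq> 0" using False by (simp add: \<beta>_def)
    have neg: "- f = f" for f :: "'k fps2"
      using fps2_char_2[OF char, of f] by (simp add: eq_neg_iff_add_eq_0)
    have "fps2_X - ?X = ?X - fps2_X" using neg[of "fps2_X - ?X"] by (metis minus_diff_eq)
    then have \<sigma>u: "\<sigma> u = u" by (simp only: u_def \<sigma>.mult \<sigma>.diff \<sigma>.const invol)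
    have "fps2_const \<beta> * u = fps2_const (\<beta> * inverse \<beta>) * (?X - fps2_X)"
      by (simp only: u_def fps2_const_mult mult.assoc)
    then have \<sigma>X: "?X = fps2_X + fps2_const \<beta> * u" using \<beta> by simp
    have u: "monic_at 0 1 u"
      using m(1) \<beta> by (auto simp: monic_at_def exp_rank_less_iff mpow_1_iff u_def \<beta>_def cf_const)
    have um: "u \<in> mpow 1" using monic_at_mpow[OF u] by simp
    \<comment> \<open>As \<open>u\<close> is monic at \<open>(0, 1)\<close>, it must replace
      \<open>fps2_Y\<close> for the family of monomials to be triangular. The swap \<open>?T\<close>
      then puts \<open>u\<close> in the first place, where a linear term of \<sigma>'(Y) in the
      first variable is harmless.\<close>
    let ?S = "fps2_subst fps2_X u" and ?T = "fps2_subst fps2_Y (fps2_X :: 'k fps2)"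
    define \<theta> where "\<theta> = (\<lambda>f. ?S (?T f))"
    have "monic_at i j (fps2_X ^ i * u ^ j)" for i j
      using monic_at_mult[OF monic_at_power[OF monic_at_X, of i] monic_at_power[OF u, of j]] by simp
    then have "bij ?S" unfolding fps2_subst_def by (rule fps2_series_bij)
    moreover have "bij ?T" by (rule involuntory_imp_bij) (rule fps2_subst_Y_X_involution)
    ultimately have bij: "bij \<theta>" using bij_comp[of ?T ?S] by (simp add: \<theta>_def o_def)
    have \<theta>: "fps2_hom \<theta>"
      unfolding \<theta>_def using um by (intro fps2_hom_comp[of ?S ?T] fps2_hom_subst) simp_all
    have \<theta>X: "\<theta> fps2_X = u" and \<theta>Y: "\<theta> fps2_Y = fps2_X"
      using um by (simp_all add: \<theta>_def fps2_subst_X fps2_subst_Y)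
    define \<tau> where "\<tau> = inv_into UNIV \<theta>"
    have \<theta>\<tau>: "\<theta> (\<tau> f) = f" for f using bij by (simp add: \<tau>_def bij_is_surj surj_f_inv_f)
    have \<tau>\<theta>: "\<tau> (\<theta> f) = f" for f using bij by (simp add: \<tau>_def bij_is_inj)
    interpret \<tau>: fps2_hom \<tau> unfolding \<tau>_def by (rule fps2_hom_inv[OF \<theta> bij])
    define \<sigma>' where "\<sigma>' = (\<lambda>f. \<tau> (\<sigma> (\<theta> f)))"
    have X': "\<sigma>' fps2_X = fps2_X" using \<tau>\<theta>[of fps2_X] by (simp add: \<sigma>'_def \<theta>X \<sigma>u)
    have Y': "\<sigma>' fps2_Y = fps2_Y + fps2_const \<beta> * fps2_X"
      using \<tau>\<theta>[of fps2_X] \<tau>\<theta>[of fps2_Y] by (simp add: \<sigma>'_def \<theta>X \<theta>Y \<sigma>X \<tau>.add \<tau>.mult)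
    have "\<exists>\<psi> z. invariants_basis \<sigma>' \<psi> z"
    proof (rule invariants_basis_monic[OF char])
      show "fps2_hom \<sigma>'"
        unfolding \<sigma>'_def using fps2_hom_comp[OF \<tau>.fps2_hom_axioms fps2_hom_comp[OF \<sigma> \<theta>]] .
      show "\<sigma>' (\<sigma>' f) = f" for f by (simp add: \<sigma>'_def \<theta>\<tau> \<tau>\<theta> invol)
      show "\<sigma>' (\<tau> f0) \<noteq> \<tau> f0" using nid by (metis \<sigma>'_def \<theta>\<tau>)
      show "monic_at 1 0 (\<sigma>' fps2_X)" unfolding X' by (rule monic_at_X)
      show "monic_at 0 1 (\<sigma>' fps2_Y)" unfolding Y'
        by (auto simp: monic_at_def exp_rank_less_iff)
    qed
    then obtain \<psi> z where "invariants_basis \<sigma>' \<psi> z" by blast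
    then have "invariants_basis \<sigma> (\<lambda>f. \<theta> (\<psi> f)) (\<theta> z)"
      unfolding \<sigma>'_def \<tau>_def by (rule invariants_basis_conjugate[OF \<theta> bij, of \<sigma>])
    then have "\<exists>z. invariants_basis \<sigma> (\<lambda>f. \<theta> (\<psi> f)) z" by (rule exI)
    then show ?thesis by (rule exI[where x = "\<lambda>f. \<theta> (\<psi> f)"])
  qed
qed

subsection \<open>The presentation of the ring of invariants\<close>

lemma ring_of_type_algebra_simps [simp]:
  "carrier (ring_of_type_algebra :: 'a::ring_1 ring) = UNIV"
  "x \<otimes>\<^bsub>(ring_of_type_algebra :: 'a::ring_1 ring)\<^esub> y = x * y"
  "x \<oplus>\<^bsub>(ring_of_type_algebra :: 'a::ring_1 ring)\<^esub> y = x + y"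
  "\<one>\<^bsub>(ring_of_type_algebra :: 'a::ring_1 ring)\<^esub> = 1"
  "\<zero>\<^bsub>(ring_of_type_algebra :: 'a::ring_1 ring)\<^esub> = 0"
  by (simp_all add: ring_of_type_algebra_def)

text \<open>Division by a monic quadratic, as a Horner scheme: multiplying the remainder by the
  variable creates one square, which is traded for linear and constant terms.\<close>

lemma poly_reduce_quadratic:
  fixes s t :: "'a::comm_ring_1"
  shows "\<exists>Q a b. P = Q * ([:0, 1:]^2 + [:s:] * [:0, 1:] + [:t:]) + [:a, b:]"
proof (induction P)
  case 0
  show ?case by (rule exI[of _ 0], rule exI[of _ 0], rule exI[of _ 0]) simp
next
  case (pCons c P)
  let ?f = "[:0, 1:]^2 + [:s:] * [:0, 1:] + [:t:]"
  obtain Q a b where P: "P = Q * ?f + [:a, b:]" using pCons.IH by blast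
  have "pCons c P = [:c:] + [:0, 1:] * P" by simp
  also have "\<dots> = ([:0, 1:] * Q + [:b:]) * ?f + [:c - b * t, a - b * s:]"
    unfolding P by (simp add: power2_eq_square algebra_simps)
  finally show ?case by blast
qed

text \<open>The first isomorphism theorem for evaluation at \<open>z\<close>. Its kernel is
  generated by the quadratic because a remainder of degree at most one that vanishes at
  \<open>z\<close> is zero by independence.\<close>

lemma invariant_ring_iso_quadratic:
  fixes \<sigma> :: "'k::field fps2 \<Rightarrow> 'k fps2"
  assumes basis: "invariants_basis \<sigma> \<psi> z" and "fps2_hom \<sigma>"
  defines "A \<equiv> (fps2_ring :: 'k fps2 ring)\<lparr>carrier := {a. \<sigma> a = a}\<rparr>"
  shows "\<exists>s t h. h \<in> algebra_iso A fps2_const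
          (fps2_poly_quot ([:0, 1:]^2 + [:s:] * [:0, 1:] + [:t:]))
          (fps2_poly_quot_const ([:0, 1:]^2 + [:s:] * [:0, 1:] + [:t:]))"
proof -
  interpret \<sigma>: fps2_hom \<sigma> by fact
  interpret \<psi>: fps2_hom \<psi> using basis by (simp add: invariants_basis_def)
  have inv: "\<sigma> f = f \<longleftrightarrow> (\<exists>a b. f = \<psi> a + \<psi> b * z)" for f
    using basis by (simp add: invariants_basis_def)
  have indep: "a = 0 \<and> b = 0" if "\<psi> a + \<psi> b * z = 0" for a b
    using basis that unfolding invariants_basis_def by (elim conjE) (drule spec, drule spec, erule mp)
  have \<psi>_inv: "\<sigma> (\<psi> a) = \<psi> a" for a
    unfolding inv by (rule exI[of _ a], rule exI[of _ 0]) simp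
  have z_inv: "\<sigma> z = z"
    unfolding inv by (rule exI[of _ 0], rule exI[of _ 1]) simp
  have "\<sigma> (z * z) = z * z" by (simp add: \<sigma>.mult z_inv)
  then obtain t' s' where zz: "z * z = \<psi> t' + \<psi> s' * z" unfolding inv by blast
  \<comment> \<open>The signs turn \<open>z * z = \<psi> t' + \<psi> s' * z\<close> into a root of
    the monic quadratic with coefficients \<open>s\<close>, \<open>t\<close>.\<close>
  define s t where "s = - s'" "t = - t'"
  define f where "f = ([:0, 1:]^2 + [:s:] * [:0, 1:] + [:t:] :: 'k fps2 poly)"
  define g where "g P = poly (map_poly \<psi> P) z" for P
  have g_pCons: "g (pCons c P) = \<psi> c + z * g P" for c P
    by (simp add: g_def map_poly_pCons)
  have g_0 [simp]: "g 0 = 0" and g_1: "g 1 = 1" by (simp_all add: g_def)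
  have g_add: "g (P + Q) = g P + g Q" for P Q
    by (induction P Q rule: poly_induct2) (simp_all add: g_pCons \<psi>.add algebra_simps)
  have g_smult: "g (smult c P) = \<psi> c * g P" for c P
    by (induction P) (simp_all add: g_pCons \<psi>.mult algebra_simps)
  have g_mult: "g (P * Q) = g P * g Q" for P Q
    by (induction P) (simp_all add: g_pCons g_add g_smult algebra_simps)
  have "g f = z * z - (\<psi> t' + \<psi> s' * z)"
    by (simp add: f_def g_add g_mult g_pCons power2_eq_square s_t_def \<psi>.uminus algebra_simps)
  then have g_f: "g f = 0" by (simp add: zz)
  have g_inv: "\<sigma> (g P) = g P" for P
    by (induction P) (simp_all add: g_pCons \<sigma>.add \<sigma>.mult \<psi>_inv z_inv)
  have g_const: "g [:fps2_const c:] = fps2_const c" for c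
    by (simp add: g_pCons)
  have kernel: "g P = 0 \<longleftrightarrow> (\<exists>Q. P = Q * f)" for P
  proof
    assume 0: "g P = 0"
    obtain Q a b where P: "P = Q * f + [:a, b:]" unfolding f_def using poly_reduce_quadratic by blast
    have "g P = g Q * g f + g [:a, b:]" unfolding P g_add g_mult ..
    then have "\<psi> a + \<psi> b * z = 0" using 0 by (simp add: g_f g_pCons mult.commute)
    from indep[OF this] have "P = Q * f" by (simp add: P)
    then show "\<exists>Q. P = Q * f" ..
  next
    assume "\<exists>Q. P = Q * f"
    then obtain Q where "P = Q * f" ..
    then show "g P = 0" by (simp only: g_mult g_f mult_zero_right)
  qed
  interpret R: cring "fps2_poly_ring :: 'k fps2 poly ring" by (rule cring_from_type_algebra)
  interpret F: cring "fps2_ring :: 'k fps2 ring" by (rule cring_from_type_algebra)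
  have subring: "subring {a. \<sigma> a = a} (fps2_ring :: 'k fps2 ring)"
  proof (rule F.subringI)
    fix h assume "h \<in> {a. \<sigma> a = a}"
    moreover have "\<ominus>\<^bsub>(fps2_ring :: 'k fps2 ring)\<^esub> h = - h"
      by (rule F.minus_equality) simp_all
    ultimately show "\<ominus>\<^bsub>(fps2_ring :: 'k fps2 ring)\<^esub> h \<in> {a. \<sigma> a = a}" by (simp add: \<sigma>.uminus)
  qed (auto simp: \<sigma>.add \<sigma>.mult)
  interpret A: ring A unfolding A_def by (rule F.subring_is_ring[OF subring])
  interpret g: ring_hom_ring fps2_poly_ring A g
    by (rule ring_hom_ringI)
      (simp_all add: R.ring_axioms A.ring_axioms, simp_all add: A_def g_add g_mult g_inv g_1)
  have ker: "a_kernel fps2_poly_ring A g = PIdl\<^bsub>fps2_poly_ring\<^esub> f"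
    unfolding a_kernel_def' cgenideal_def by (auto simp: A_def kernel)
  have surj: "g ` carrier fps2_poly_ring = carrier A"
  proof -
    have "\<exists>P. w = g P" if w: "\<sigma> w = w" for w
    proof -
      obtain a b where "w = \<psi> a + \<psi> b * z" using w unfolding inv by blast
      then have "w = g [:a, b:]" by (simp add: g_pCons mult.commute)
      then show ?thesis ..
    qed
    then show ?thesis by (auto simp: A_def g_inv)
  qed
  \<comment> \<open>The induced isomorphism leads from the quotient to the invariants; its inverse
    is the required map, so compatibility with constants is checked through
    \<open>?k\<close>.\<close>
  let ?Q = "fps2_poly_quot f" and ?k = "\<lambda>C. the_elem (g ` C)"
  have k: "?k \<in> ring_iso ?Q A"
    using g.FactRing_iso_set[OF surj] unfolding ker fps2_poly_quot_def .
  have "ring ?Q"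
    unfolding fps2_poly_quot_def by (intro ideal.quotient_is_ring R.cgenideal_ideal) simp
  from ring_iso_set_sym[OF this k] have iso: "inv_into (carrier ?Q) ?k \<in> ring_iso A ?Q" .
  have "inv_into (carrier ?Q) ?k (fps2_const c) = fps2_poly_quot_const f c" for c
  proof (rule inv_into_f_eq)
    show "inj_on ?k (carrier ?Q)" using k by (simp add: ring_iso_def bij_betw_def)
    show "fps2_poly_quot_const f c \<in> carrier ?Q"
      unfolding fps2_poly_quot_const_def fps2_poly_quot_def FactRing_def A_RCOSETS_def'
      by auto
    show "?k (fps2_poly_quot_const f c) = fps2_const c"
      using g.the_elem_simp[of "[:fps2_const c:]"]
      unfolding ker fps2_poly_quot_const_def by (simp add: g_const)
  qed
  then show ?thesis using iso unfolding algebra_iso_def f_def by blast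
qed

theorem proposition10p1:
  fixes \<phi> :: "int \<Rightarrow> 'k::alg_closed_field fps2 \<Rightarrow> 'k fps2"
  assumes "CHAR('k) = 2"
    and "algebra_action (integer_mod_group 2) fps2_ring fps2_const \<phi>"
    and "nontrivial_action (integer_mod_group 2) fps2_ring \<phi>"
  shows "\<exists>s t :: 'k fps2. \<exists>h.
    h \<in> algebra_iso
          (invariant_ring (integer_mod_group 2) fps2_ring \<phi>) fps2_const
          (fps2_poly_quot ([:0, 1:]^2 + [:s:] * [:0, 1:] + [:t:]))
          (fps2_poly_quot_const ([:0, 1:]^2 + [:s:] * [:0, 1:] + [:t:]))"
proof -
  \<comment> \<open>With a single nonzero group element, the action amounts to the involution
    \<open>\<phi> 1\<close>, and the invariants are its fixed elements.\<close>
  have carrier: "carrier (integer_mod_group 2) = {0, 1}"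
    by (auto simp: carrier_integer_mod_group)
  interpret group_action "integer_mod_group 2" UNIV \<phi>
    using assms(2) by (simp add: algebra_action_def)
  have \<phi>0: "\<phi> 0 f = f" for f
    using id_eq_one by (metis UNIV_I one_integer_mod_group restrict_apply)
  have invol: "\<phi> 1 (\<phi> 1 f) = f" for f
    using composition_rule[of f 1 1] by (simp add: carrier \<phi>0)
  have "\<phi> 1 \<in> algebra_iso fps2_ring fps2_const fps2_ring fps2_const"
    using assms(2) by (simp add: algebra_action_def carrier)
  then have hom: "fps2_hom (\<phi> 1)"
    by (auto simp: algebra_iso_def ring_iso_def ring_hom_def fps2_hom_def)
  obtain f0 where "\<phi> 1 f0 \<noteq> f0"
    using assms(3) \<phi>0 by (auto simp: nontrivial_action_def carrier)
  then obtain \<psi> z where "invariants_basis (\<phi> 1) \<psi> z"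
    using involution_invariants_basis[OF assms(1) hom invol] by blast
  moreover have "invariant_ring (integer_mod_group 2) fps2_ring \<phi> =
      fps2_ring\<lparr>carrier := {a. \<phi> 1 a = a}\<rparr>"
    by (simp add: invariant_ring_def carrier \<phi>0)
  ultimately show ?thesis
    using invariant_ring_iso_quadratic[OF _ hom] by simp
qed

end
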